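(* Let $u\in H_0^1(0,1)$ be the solution of $$b(v,u)=(f,v)\qquad\text{for all }v\in H_0^1(0,1),$$ and let $u_h\in\mathcal{M}_h$ be the solution of the upwinding Petrov-Galerkin formulation $$b(v_h,u_h)=(f,v_h)\qquad\text{for all }v_h\in V_h .$$ If $h$ is chosen such that $$\varepsilon^2+\frac{h^2}{\pi^2}\le(\varepsilon+h\,b_1)^2,$$ then $$\|u-u_h\|_{*,h}\le\sqrt{1+b_2}\,\inf_{p_h\in\mathcal{M}_h}\|u-p_h\|_{*,h}.$$
   Context: Let $\varepsilon>0$, let $f$ be a continuous function on $[0,1]$, let $n\ge 2$ be an integer, $h=1/n$, and $x_j=jh$ for $j=0,\dots,n$. Here $(f,v)=\int_0^1 fv\,dx$, $b(v,u)=\varepsilon\int_0^1 u'v'\,dx+\int_0^1 u'v\,dx$ for $u,v\in H_0^1(0,1)$, and $|u|^2=\int_0^1 (u'(x))^2\,dx$. Trial space: $\mathcal{M}_h=\mathrm{span}\{\varphi_j\}_{j=1}^{n-1}$ is the space of continuous functions on $[0,1]$ that are linear on each $[x_{j-1},x_j]$ and vanish at $0$ and $1$; $\varphi_j$ are the nodal basis functions, $\varphi_j(x_i)=\delta_{ij}$. Bubble functions: let $B:[0,h]\to\mathbb{R}$ be a continuous function (with weak derivative $B'\in L^2(0,h)$) such that $B(0)=B(h)=0$, $\int_0^h B(x)\,dx=b_1h$ with $b_1>0$, and $\int_0^h (B'(x))^2\,dx=b_2/h$ with $b_2>0$. For $i=1,\dots,n$ let $B_i(x)=B(x-x_{i-1})$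 on $[x_{i-1},x_i]$ and $B_i=0$ on the rest of $[0,1]$. Test space: $V_h=\mathrm{span}\{\varphi_j+(B_j-B_{j+1})\}_{j=1}^{n-1}\subset H_0^1(0,1)$. The discrete optimal trial norm, considered on all of $H_0^1(0,1)$, is given by $$\|u\|_{*,h}^2=\frac{(\varepsilon+h\,b_1)^2}{1+b_2}\,|u|^2+\frac{1}{1+b_2}\,|u|_{*,h}^2,$$ where $$|u|_{*,h}^2:=\frac1n\sum_{i=1}^n\left(\frac1h\int_{x_{i-1}}^{x_i}u(x)\,dx\right)^2-\left(\int_0^1u(x)\,dx\right)^2 .$$ *)

theory Defs
  imports "HOL-Analysis.Analysis"
begin

section \<open>Sobolev spaces on a bounded interval\<close>

text \<open>
  Elements of the function spaces on the interval (a,b) are represented by (Borel) functions on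
  the real line; only their restriction to (a,b), up to a null set, is relevant.
\<close>

definition smooth :: "(real \<Rightarrow> real) \<Rightarrow> bool" where
  "smooth \<phi> \<longleftrightarrow> (\<forall>k. (deriv ^^ k) \<phi> differentiable_on UNIV)"

definition test_functions :: "real \<Rightarrow> real \<Rightarrow> (real \<Rightarrow> real) set" where
  "test_functions a b =
     {\<phi>. smooth \<phi> \<and> (\<exists>K. compact K \<and> K \<subseteq> {a<..<b} \<and> (\<forall>x. x \<notin> K \<longrightarrow> \<phi> x = 0))}"

definition L2 :: "real \<Rightarrow> real \<Rightarrow> (real \<Rightarrow> real) set" where
  "L2 a b = {u. set_borel_measurable lborel {a<..<b} u \<and>
                set_integrable lborel {a<..<b} (\<lambda>x. (u x)\<^sup>2)}"

definition has_weak_deriv :: "real \<Rightarrow> real \<Rightarrow> (real \<Rightarrow> real) \<Rightarrow> (real \<Rightarrow> real) \<Rightarrow> bool" where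
  "has_weak_deriv a b u g \<longleftrightarrow>
     g \<in> L2 a b \<and>
     (\<forall>\<phi>\<in>test_functions a b.
        (LINT x:{a<..<b}|lborel. u x * deriv \<phi> x) = - (LINT x:{a<..<b}|lborel. g x * \<phi> x))"

text \<open>The weak derivative is unique up to a null set, so the choice below is immaterial.\<close>

definition weak_deriv :: "real \<Rightarrow> real \<Rightarrow> (real \<Rightarrow> real) \<Rightarrow> real \<Rightarrow> real" where
  "weak_deriv a b u = (SOME g. has_weak_deriv a b u g)"

definition H1 :: "real \<Rightarrow> real \<Rightarrow> (real \<Rightarrow> real) set" where
  "H1 a b = {u \<in> L2 a b. \<exists>g. has_weak_deriv a b u g}"

definition H1_norm :: "real \<Rightarrow> real \<Rightarrow> (real \<Rightarrow> real) \<Rightarrow> real" where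
  "H1_norm a b u = sqrt ((LINT x:{a<..<b}|lborel. (u x)\<^sup>2) +
                         (LINT x:{a<..<b}|lborel. (weak_deriv a b u x)\<^sup>2))"

text \<open>The closure of the test functions in the Sobolev norm.\<close>

definition H01 :: "real \<Rightarrow> real \<Rightarrow> (real \<Rightarrow> real) set" where
  "H01 a b = {u \<in> H1 a b. \<exists>\<phi>. (\<forall>k. \<phi> k \<in> test_functions a b) \<and>
                (\<lambda>k::nat. H1_norm a b (\<lambda>x. u x - \<phi> k x)) \<longlonglongrightarrow> 0}"


section \<open>The convection-diffusion problem on (0,1)\<close>

definition L2_prod :: "(real \<Rightarrow> real) \<Rightarrow> (real \<Rightarrow> real) \<Rightarrow> real" where
  "L2_prod f v = (LINT x:{0<..<1}|lborel. f x * v x)"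

text \<open>The first function argument is the test function.\<close>

definition bform :: "real \<Rightarrow> (real \<Rightarrow> real) \<Rightarrow> (real \<Rightarrow> real) \<Rightarrow> real" where
  "bform \<epsilon> v u =
     \<epsilon> * (LINT x:{0<..<1}|lborel. weak_deriv 0 1 u x * weak_deriv 0 1 v x) +
     (LINT x:{0<..<1}|lborel. weak_deriv 0 1 u x * v x)"

definition energy_seminorm :: "(real \<Rightarrow> real) \<Rightarrow> real" where
  "energy_seminorm u = sqrt (LINT x:{0<..<1}|lborel. (weak_deriv 0 1 u x)\<^sup>2)"


section \<open>Discretization on the uniform mesh with \<open>n\<close> subintervals\<close>

definition mesh :: "nat \<Rightarrow> real" where
  "mesh n = 1 / real n"

definition node :: "nat \<Rightarrow> nat \<Rightarrow> real" where
  "node n j = real j * mesh n"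

definition hat :: "nat \<Rightarrow> nat \<Rightarrow> real \<Rightarrow> real" where
  "hat n j x = max 0 (1 - \<bar>x - node n j\<bar> / mesh n)"

lemma hat_node:
  assumes "n > 0"
  shows "hat n j (node n i) = (if i = j then 1 else 0)"
proof -
  have "node n i - node n j = (real i - real j) / real n"
    by (simp add: node_def mesh_def diff_divide_distrib)
  then have "\<bar>node n i - node n j\<bar> / mesh n = \<bar>real i - real j\<bar>"
    using assms by (simp add: mesh_def)
  then show ?thesis
    by (cases i j rule: linorder_cases) (auto simp: hat_def max_def)
qed

definition bubble :: "nat \<Rightarrow> (real \<Rightarrow> real) \<Rightarrow> nat \<Rightarrow> real \<Rightarrow> real" where
  "bubble n B i x =
     (if x \<in> {node n (i - 1)..node n i} then B (x - node n (i - 1)) else 0)"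

definition trial_space :: "nat \<Rightarrow> (real \<Rightarrow> real) set" where
  "trial_space n = {\<lambda>x. \<Sum>j = 1..n - 1. c j * hat n j x | c :: nat \<Rightarrow> real. True}"

definition test_space :: "nat \<Rightarrow> (real \<Rightarrow> real) \<Rightarrow> (real \<Rightarrow> real) set" where
  "test_space n B =
     {\<lambda>x. \<Sum>j = 1..n - 1. c j * (hat n j x + (bubble n B j x - bubble n B (j + 1) x))
      | c :: nat \<Rightarrow> real. True}"

definition discrete_seminorm_sq :: "nat \<Rightarrow> (real \<Rightarrow> real) \<Rightarrow> real" where
  "discrete_seminorm_sq n u =
     1 / real n *
       (\<Sum>i = 1..n. (1 / mesh n * (LINT x:{node n (i - 1)<..<node n i}|lborel. u x))\<^sup>2) -
     (LINT x:{0<..<1}|lborel. u x)\<^sup>2"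

definition discrete_optimal_norm ::
    "real \<Rightarrow> real \<Rightarrow> real \<Rightarrow> nat \<Rightarrow> (real \<Rightarrow> real) \<Rightarrow> real" where
  "discrete_optimal_norm \<epsilon> b\<^sub>1 b\<^sub>2 n u =
     sqrt ((\<epsilon> + mesh n * b\<^sub>1)\<^sup>2 / (1 + b\<^sub>2) * (energy_seminorm u)\<^sup>2 +
           1 / (1 + b\<^sub>2) * discrete_seminorm_sq n u)"

end

theory Submission
  imports Defs
begin

text \<open>
  Write \<open>\<kappa> = \<epsilon> + h b\<^sub>1\<close>, let \<open>P\<close> be the discrete solution operator, and let \<open>N w = (1 + b\<^sub>2) \<parallel>w\<parallel>\<^sup>2\<close>, where
  \<open>\<parallel>.\<parallel>\<close> is the discrete optimal norm.  The proof has three ingredients.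

  Stability on the trial space.  A trial function \<open>q\<close> has slopes \<open>s\<^sub>i\<close>, and a test function \<open>v\<close> has on
  the \<open>i\<close>-th cell the derivative \<open>d\<^sub>i (1 + h B')\<close>, where the \<open>d\<^sub>i\<close> sum to zero.  The bubbles turn \<open>\<epsilon>\<close> into
  \<open>\<kappa>\<close>: one finds \<open>b(v,q) = h \<Sum> d\<^sub>i (\<kappa> s\<^sub>i - m\<^sub>i)\<close> with \<open>m\<^sub>i\<close> the cell means of \<open>q\<close>
  (\<open>conv_form_trial_test\<close>).  The best slopes are the residual itself made mean free,
  \<open>d\<^sub>i = \<kappa> s\<^sub>i - m\<^sub>i + m\<close>.  For them \<open>b(v,q) = h \<Sum> d\<^sub>i\<^sup>2 = N q\<close> (\<open>norm_form_trial\<close>), whereas always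
  \<open>|v|\<^sup>2 = (1 + b\<^sub>2) h \<Sum> d\<^sub>i\<^sup>2\<close> (\<open>mesh_deriv_energy\<close>).

  Boundedness on the whole space.  For \<open>w\<close> vanishing at both ends with mean \<open>\<mu>\<close>,
  \<open>b(v,w) = \<integral> (\<epsilon> w' - w + \<mu>) v'\<close>, and the square of the \<open>L\<^sup>2\<close> norm of \<open>\<epsilon> w' - w + \<mu>\<close> is
  \<open>\<epsilon>\<^sup>2 |w|\<^sup>2 + \<integral> (w - \<mu>)\<^sup>2\<close>, since \<open>w w'\<close> integrates to zero.  The Poincare-Wirtinger inequality with
  the sharp constant \<open>h/\<pi>\<close> on every cell bounds the last integral by
  \<open>(h/\<pi>)\<^sup>2 |w|\<^sup>2 + |w|\<^sub>*\<^sub>,\<^sub>h\<^sup>2\<close>, and the mesh condition makes the sum at most \<open>N w\<close>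
  (\<open>residual_energy_le_norm_form\<close>).

  Together these give \<open>N (P w) \<le> (1 + b\<^sub>2) N w\<close>.  The error of the method is governed by \<open>I - P\<close>, and
  in an inner product space a projection and its complement have the same norm
  (\<open>complementary_projection_bound\<close>); this preserves the constant \<open>1 + b\<^sub>2\<close>.

  To make these computations legitimate, weak derivatives are translated into primitives: by the
  lemma of du Bois-Reymond a function with weak derivative \<open>g\<close> is a.e. a primitive of \<open>g\<close>, and an
  element of \<open>H\<^sub>0\<^sup>1\<close> is the primitive that vanishes at both ends (\<open>H01_zero_primitive\<close>).  The same lemma
  integrates the differential equation once, so that the weak equation may be tested with every
  such primitive, in particular with the bubble-enriched test functions
  (\<open>weak_solution_tests_primitives\<close>).
\<close>

section \<open>Smooth cutoff functions\<close>

text \<open>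
  \<open>cdiff k f\<close> says that \<open>f\<close> is \<open>k + 1\<close> times differentiable.  Peeling derivatives off from the
  inside, instead of iterating \<open>deriv\<close> on the outside as in the definition of smoothness, lets the
  product and chain rules go through by induction on \<open>k\<close>.
\<close>
primrec cdiff :: "nat \<Rightarrow> (real \<Rightarrow> real) \<Rightarrow> bool" where
  "cdiff 0 f \<longleftrightarrow> f differentiable_on UNIV"
| "cdiff (Suc k) f \<longleftrightarrow> f differentiable_on UNIV \<and> cdiff k (deriv f)"

lemma cdiff_differentiable: "cdiff k f \<Longrightarrow> f differentiable_on UNIV"
  by (cases k) auto

lemma cdiff_DERIV: "cdiff k f \<Longrightarrow> (f has_real_derivative deriv f x) (at x)"
  using cdiff_differentiable[of k f]
  by (auto simp: differentiable_on_def DERIV_deriv_iff_real_differentiable)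

lemma cdiff_mono: "cdiff (Suc k) f \<Longrightarrow> cdiff k f"
  by (induction k arbitrary: f) auto

lemma cdiff_iff: "cdiff k f \<longleftrightarrow> (\<forall>j\<le>k. (deriv ^^ j) f differentiable_on UNIV)"
proof (induction k arbitrary: f)
  case (Suc k)
  have "(\<forall>j\<le>Suc k. (deriv ^^ j) f differentiable_on UNIV) \<longleftrightarrow>
        f differentiable_on UNIV \<and> (\<forall>j\<le>k. (deriv ^^ Suc j) f differentiable_on UNIV)"
    by (metis Suc_le_mono funpow_0 not0_implies_Suc zero_le)
  then show ?case using Suc[of "deriv f"] by (simp add: funpow_swap1)
qed simp

lemma smooth_iff_cdiff: "smooth f \<longleftrightarrow> (\<forall>k. cdiff k f)"
  unfolding smooth_def cdiff_iff by blast

lemma cdiff_SucI: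
  assumes "\<And>x. (f has_real_derivative f' x) (at x)" "cdiff k f'"
  shows "cdiff (Suc k) f"
proof -
  have "deriv f = f'" using assms(1) by (auto intro: DERIV_imp_deriv)
  moreover have "f differentiable_on UNIV"
    using assms(1) unfolding differentiable_on_def by (meson differentiableI has_field_derivative_imp_has_derivative has_field_derivative_at_within)
  ultimately show ?thesis using assms(2) by simp
qed

lemma cdiff_0I: "(\<And>x. (f has_real_derivative f' x) (at x)) \<Longrightarrow> cdiff 0 f"
  unfolding cdiff.simps differentiable_on_def
  by (meson differentiableI has_field_derivative_imp_has_derivative has_field_derivative_at_within)

lemma cdiff_add: "cdiff k f \<Longrightarrow> cdiff k g \<Longrightarrow> cdiff k (\<lambda>x. f x + g x)"
proof (induction k arbitrary: f g)
  case 0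
  then show ?case by (auto intro: differentiable_on_add)
next
  case (Suc k)
  show ?case
    by (rule cdiff_SucI[of _ "\<lambda>x. deriv f x + deriv g x"])
       (use Suc in \<open>auto intro!: derivative_eq_intros cdiff_DERIV[of "Suc k"]\<close>)
qed

lemma cdiff_mult: "cdiff k f \<Longrightarrow> cdiff k g \<Longrightarrow> cdiff k (\<lambda>x. f x * g x)"
proof (induction k arbitrary: f g)
  case 0
  then show ?case by (auto intro: differentiable_on_mult)
next
  case (Suc k)
  have fg: "cdiff k f" "cdiff k g" using Suc.prems cdiff_mono by blast+
  show ?case
  proof (rule cdiff_SucI[of _ "\<lambda>x. deriv f x * g x + deriv g x * f x"])
    show "((\<lambda>x. f x * g x) has_real_derivative deriv f x * g x + deriv g x * f x) (at x)" for x
      by (intro DERIV_mult cdiff_DERIV[of "Suc k"] Suc.prems)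
    show "cdiff k (\<lambda>x. deriv f x * g x + deriv g x * f x)"
      using Suc fg by (intro cdiff_add Suc.IH) auto
  qed
qed

lemma cdiff_const: "cdiff k (\<lambda>x. c)"
  by (induction k arbitrary: c) (auto simp: deriv_const)

lemma cdiff_affine: "cdiff k f \<Longrightarrow> cdiff k (\<lambda>x. f (p * x + q))"
proof (induction k arbitrary: f)
  case 0
  show ?case
    by (rule cdiff_0I[of _ "\<lambda>x. deriv f (p * x + q) * p"])
       (rule DERIV_chain2[of f], rule cdiff_DERIV[OF 0], auto intro!: derivative_eq_intros)
next
  case (Suc k)
  show ?case
  proof (rule cdiff_SucI[of _ "\<lambda>x. deriv f (p * x + q) * p"])
    show "((\<lambda>x. f (p * x + q)) has_real_derivative deriv f (p * x + q) * p) (at x)" for x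
      by (rule DERIV_chain2[of f], rule cdiff_DERIV[OF Suc.prems], auto intro!: derivative_eq_intros)
    show "cdiff k (\<lambda>x. deriv f (p * x + q) * p)"
      using Suc by (intro cdiff_mult cdiff_const Suc.IH) auto
  qed
qed

text \<open>
  The functions \<open>p(1/x) exp(-1/x)\<close> for \<open>x > 0\<close>, extended by zero, form a family closed under
  differentiation when \<open>p\<close> ranges over all polynomials; this is why \<open>exp(-1/x)\<close> is smooth at 0.
\<close>
definition flat_exp :: "real poly \<Rightarrow> real \<Rightarrow> real" where
  "flat_exp P x = (if x > 0 then poly P (1/x) * exp (- (1/x)) else 0)"

lemma poly_exp_tendsto_0:
  fixes P :: "real poly"
  shows "((\<lambda>y. poly P y * exp (- y)) \<longlongrightarrow> 0) at_top"
proof (induction P)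
  case (pCons a P)
  have *: "((\<lambda>y::real. y ^ k * exp (- y)) \<longlongrightarrow> 0) at_top" for k :: nat
    using tendsto_power_div_exp_0[of k] by (simp add: exp_minus divide_inverse)
  have gen: "((\<lambda>y::real. y ^ k * (poly Q y * exp (- y))) \<longlongrightarrow> 0) at_top" for Q :: "real poly" and k
  proof (induction Q arbitrary: k)
    case (pCons b Q)
    have "((\<lambda>y. b * (y ^ k * exp (- y)) + y ^ Suc k * (poly Q y * exp (- y))) \<longlongrightarrow> b * 0 + 0) at_top"
      by (intro tendsto_add tendsto_mult tendsto_const * pCons)
    then show ?case by (simp add: algebra_simps)
  qed simp
  show ?case using gen[of 0 "pCons a P"] by simp
qed simp

lemma flat_exp_DERIV:
  "(flat_exp P has_real_derivative flat_exp ([:0,0,1:] * (P - pderiv P)) x) (at x)"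
proof -
  let ?Q = "[:0,0,1:] * (P - pderiv P)"
  consider "x > 0" | "x < 0" | "x = 0" by linarith
  then show ?thesis
  proof cases
    case 1
    have "((\<lambda>x. poly P (1/x) * exp (- (1/x))) has_real_derivative flat_exp ?Q x) (at x)"
      using 1 by (auto intro!: derivative_eq_intros DERIV_chain2[OF poly_DERIV]
                       simp: flat_exp_def field_simps power2_eq_square)
    moreover have "\<forall>\<^sub>F y in nhds x. poly P (1/y) * exp (- (1/y)) = flat_exp P y"
      using eventually_nhds_in_open[of "{0<..}" x] 1 
      by (auto elim!: eventually_mono simp: flat_exp_def)
    ultimately show ?thesis by (subst DERIV_cong_ev[OF refl _ refl]) (auto simp: eq_commute elim: eventually_mono)
  next
    case 2
    have "((\<lambda>x. 0) has_real_derivative flat_exp ?Q x) (at x)"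
      using 2 by (simp add: flat_exp_def)
    moreover have "\<forall>\<^sub>F y in nhds x. flat_exp P y = 0"
      using eventually_nhds_in_open[of "{..<0}" x] 2
      by (auto elim!: eventually_mono simp: flat_exp_def)
    ultimately show ?thesis by (subst DERIV_cong_ev[OF refl _ refl]) auto
  next
    case 3
    have "((\<lambda>y. flat_exp P y / y) \<longlongrightarrow> 0) (at_right 0)"
    proof -
      have "((\<lambda>y. poly (pCons 0 P) (inverse y) * exp (- inverse y)) \<longlongrightarrow> 0) (at_right 0)"
        by (rule filterlim_compose[OF poly_exp_tendsto_0 filterlim_inverse_at_top_right])
      moreover have "\<forall>\<^sub>F y in at_right 0. poly (pCons 0 P) (inverse y) * exp (- inverse y) = flat_exp P y / y"
        by (auto simp: eventually_at_filter flat_exp_def field_simps)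
      ultimately show ?thesis using Lim_transform_eventually by fast
    qed
    moreover have "((\<lambda>y. flat_exp P y / y) \<longlongrightarrow> 0) (at_left 0)"
      by (rule tendsto_eventually) (auto simp: eventually_at_filter flat_exp_def)
    ultimately have "((\<lambda>y. flat_exp P y / y) \<longlongrightarrow> 0) (at 0)"
      by (simp add: filterlim_split_at)
    then show ?thesis using 3 by (simp add: has_field_derivative_iff flat_exp_def)
  qed
qed

lemma cdiff_flat_exp: "cdiff k (flat_exp P)"
  by (induction k arbitrary: P) (blast intro: cdiff_0I cdiff_SucI flat_exp_DERIV)+

definition cutoff :: "real \<Rightarrow> real" where "cutoff = flat_exp 1"

lemma cutoff_eq: "cutoff x = (if x > 0 then exp (- (1/x)) else 0)"
  by (simp add: cutoff_def flat_exp_def)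

lemma cutoff_bounds: "0 \<le> cutoff x" "cutoff x \<le> 1"
  by (auto simp: cutoff_eq)

text \<open>
  Steepening the product of two cutoffs gives test functions with values in \<open>[0,1]\<close> that converge
  pointwise to the indicator of \<open>(c,d)\<close>, which is all that the fundamental lemma below asks for.
\<close>
definition plateau :: "real \<Rightarrow> real \<Rightarrow> nat \<Rightarrow> real \<Rightarrow> real" where
  "plateau c d k x = cutoff (real k * (x - c)) * cutoff (real k * (d - x))"

lemma smooth_plateau: "smooth (plateau c d k)"
proof -
  have "cdiff j (\<lambda>x. cutoff (real k * x + - (real k * c)) * cutoff (- real k * x + real k * d))" for j
    unfolding cutoff_def by (intro cdiff_mult cdiff_affine cdiff_flat_exp)
  moreover have "plateau c d k = (\<lambda>x. cutoff (real k * x + - (real k * c)) * cutoff (- real k * x + real k * d))"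
    by (rule ext) (simp add: plateau_def right_diff_distrib)
  ultimately show ?thesis by (simp add: smooth_iff_cdiff)
qed

lemma plateau_outside: "x \<notin> {c..d} \<Longrightarrow> plateau c d k x = 0"
  by (auto simp: plateau_def cutoff_eq zero_less_mult_iff)

lemma plateau_test:
  assumes "a < c" "d < b" shows "plateau c d k \<in> test_functions a b"
  unfolding test_functions_def
  using assms smooth_plateau plateau_outside[of _ c d k]
  by (auto intro!: exI[of _ "{c..d}"])

lemma plateau_bounds: "0 \<le> plateau c d k x" "plateau c d k x \<le> 1"
  unfolding plateau_def using cutoff_bounds by (auto intro: mult_le_one)

lemma plateau_tendsto: "(\<lambda>k. plateau c d k x) \<longlonglongrightarrow> indicator {c<..<d} x"
proof -
  have *: "(\<lambda>k. cutoff (real k * t)) \<longlonglongrightarrow> (if t > 0 then 1 else 0)" for t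
  proof (cases "t > 0")
    case True
    have "(\<lambda>k. exp (- (inverse (real k) * (1 / t)))) \<longlonglongrightarrow> exp (- (0 * (1 / t)))"
      by (intro tendsto_intros lim_inverse_n)
    moreover have "\<forall>\<^sub>F k in sequentially. exp (- (inverse (real k) * (1 / t))) = cutoff (real k * t)"
      using eventually_gt_at_top[of 0]
      by eventually_elim (use True in \<open>auto simp: cutoff_eq field_simps\<close>)
    ultimately show ?thesis using True by (auto intro: Lim_transform_eventually)
  next
    case False
    then have "cutoff (real k * t) = 0" for k by (auto simp: cutoff_eq zero_less_mult_iff)
    then show ?thesis using False by simp
  qed
  have "(\<lambda>k. plateau c d k x) \<longlonglongrightarrow> (if x - c > 0 then 1 else 0) * (if d - x > 0 then 1 else 0)"
    unfolding plateau_def by (intro tendsto_mult *)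
  then show ?thesis by (auto simp: indicator_def)
qed

lemma test_DERIV: "\<phi> \<in> test_functions a b \<Longrightarrow> (\<phi> has_real_derivative deriv \<phi> x) (at x)"
  by (auto simp: test_functions_def smooth_iff_cdiff intro: cdiff_DERIV)

lemma test_continuous: "\<phi> \<in> test_functions a b \<Longrightarrow> continuous_on A \<phi>"
  by (meson DERIV_isCont continuous_at_imp_continuous_on test_DERIV)

lemma test_deriv_continuous: "\<phi> \<in> test_functions a b \<Longrightarrow> continuous_on A (deriv \<phi>)"
proof -
  assume "\<phi> \<in> test_functions a b"
  then have "cdiff (Suc 0) \<phi>" by (simp add: test_functions_def smooth_iff_cdiff del: cdiff.simps)
  then have "deriv \<phi> differentiable_on UNIV" by simp
  then show ?thesis
    using continuous_on_subset differentiable_imp_continuous_on by blast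
qed

lemma test_zero: "\<phi> \<in> test_functions a b \<Longrightarrow> x \<notin> {a<..<b} \<Longrightarrow> \<phi> x = 0"
  by (auto simp: test_functions_def)

lemma test_lincomb:
  assumes "\<phi> \<in> test_functions a b" "\<psi> \<in> test_functions a b"
  shows "(\<lambda>x. \<phi> x + c * \<psi> x) \<in> test_functions a b"
proof -
  obtain K L where "compact K" "K \<subseteq> {a<..<b}" "\<forall>x. x \<notin> K \<longrightarrow> \<phi> x = 0"
    "compact L" "L \<subseteq> {a<..<b}" "\<forall>x. x \<notin> L \<longrightarrow> \<psi> x = 0"
    using assms by (auto simp: test_functions_def)
  then have "\<exists>K. compact K \<and> K \<subseteq> {a<..<b} \<and> (\<forall>x. x \<notin> K \<longrightarrow> \<phi> x + c * \<psi> x = 0)"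
    by (intro exI[of _ "K \<union> L"]) auto
  moreover have "smooth (\<lambda>x. \<phi> x + c * \<psi> x)"
    using assms unfolding test_functions_def smooth_iff_cdiff
    by (auto intro!: cdiff_add cdiff_mult cdiff_const)
  ultimately show ?thesis by (simp add: test_functions_def)
qed

section \<open>Square-integrable functions on an interval\<close>
lemma set_integral_cong_AE_borel:
  fixes f g :: "'a \<Rightarrow> real"
  assumes "set_borel_measurable M A f" "set_borel_measurable M A g"
    and "AE x\<in>A in M. f x = g x"
  shows "(LINT x:A|M. f x) = (LINT x:A|M. g x)"
  unfolding set_lebesgue_integral_def
proof (rule integral_cong_AE)
  show "AE x in M. indicator A x *\<^sub>R f x = indicator A x *\<^sub>R g x"
    using assms(3) by eventually_elim (simp add: indicator_def)
qed (use assms in \<open>auto simp: set_borel_measurable_def\<close>)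

lemma set_integrable_borel: "set_integrable M A f \<Longrightarrow> set_borel_measurable M A f"
  unfolding set_integrable_def set_borel_measurable_def by (rule borel_measurable_integrable)

lemma set_borel_measurable_mult:
  fixes f g :: "real \<Rightarrow> real"
  assumes "set_borel_measurable M A f" "set_borel_measurable M A g"
  shows "set_borel_measurable M A (\<lambda>x. f x * g x)"
proof -
  have "(\<lambda>x. (indicator A x *\<^sub>R f x) * (indicator A x *\<^sub>R g x)) \<in> borel_measurable M"
    using assms unfolding set_borel_measurable_def by measurable
  moreover have "(\<lambda>x. (indicator A x *\<^sub>R f x) * (indicator A x *\<^sub>R g x)) = (\<lambda>x. indicator A x *\<^sub>R (f x * g x))"
    by (auto simp: indicator_def)
  ultimately show ?thesis unfolding set_borel_measurable_def by simp
qed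

lemma set_borel_measurable_lincomb:
  fixes f g :: "real \<Rightarrow> real"
  assumes "set_borel_measurable M A f" "set_borel_measurable M A g"
  shows "set_borel_measurable M A (\<lambda>x. p * f x + q * g x)"
proof -
  have "(\<lambda>x. p * (indicator A x *\<^sub>R f x) + q * (indicator A x *\<^sub>R g x)) \<in> borel_measurable M"
    using assms unfolding set_borel_measurable_def by measurable
  moreover have "(\<lambda>x. p * (indicator A x *\<^sub>R f x) + q * (indicator A x *\<^sub>R g x)) = (\<lambda>x. indicator A x *\<^sub>R (p * f x + q * g x))"
    by (auto simp: indicator_def)
  ultimately show ?thesis unfolding set_borel_measurable_def by simp
qed

lemma continuous_bounded_integrable:
  fixes G g :: "real \<Rightarrow> real"
  assumes "continuous_on {a..b} G" "set_integrable lborel {a<..<b} g"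
  shows "set_integrable lborel {a<..<b} (\<lambda>x. G x * g x)"
proof -
  have "compact (G ` {a..b})" using assms by (intro compact_continuous_image) auto
  then obtain K where K: "\<And>x. x \<in> {a..b} \<Longrightarrow> \<bar>G x\<bar> \<le> K" by (metis compact_imp_bounded bounded_iff imageI real_norm_def)
  have "set_borel_measurable lborel {a<..<b} G"
    unfolding set_borel_measurable_def measurable_lborel2 using assms(1)
    by (intro borel_measurable_continuous_on_indicator) (auto intro: continuous_on_subset)
  then have "set_borel_measurable lborel {a<..<b} (\<lambda>x. G x * g x)"
    using set_integrable_borel[OF assms(2)] by (rule set_borel_measurable_mult)
  moreover have "set_integrable lborel {a<..<b} (\<lambda>x. K * g x)" using assms by auto
  moreover have "\<bar>G x * g x\<bar> \<le> \<bar>K * g x\<bar>" if "x \<in> {a<..<b}" for x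
    using K[of x] that by (auto simp: abs_mult intro!: mult_right_mono)
  ultimately show ?thesis
    by (rule_tac set_integrable_bound[of _ _ "\<lambda>x. K * g x"]) auto
qed

lemma continuous_integrable:
  fixes G :: "real \<Rightarrow> real"
  assumes "continuous_on {a..b} G"
  shows "set_integrable lborel {a<..<b} G"
  using borel_integrable_atLeastAtMost'[OF assms] by (rule set_integrable_subset) auto

lemma set_integrable_const: "set_integrable lborel {a<..<b::real} (\<lambda>x. c :: real)"
  by (rule continuous_integrable) (rule continuous_on_const)

lemma set_integral_const_Ioo: "a \<le> b \<Longrightarrow> (LINT x:{a<..<b}|lborel. (c::real)) = c * (b - a)"
  by (subst set_integral_const) auto

lemma L2_I:
  "set_borel_measurable lborel {a<..<b} u \<Longrightarrow> set_integrable lborel {a<..<b} (\<lambda>x. (u x)\<^sup>2) \<Longrightarrow> u \<in> L2 a b"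
  by (simp add: L2_def)

lemma L2_borel: "u \<in> L2 a b \<Longrightarrow> set_borel_measurable lborel {a<..<b} u"
  by (simp add: L2_def)

lemma L2_square: "u \<in> L2 a b \<Longrightarrow> set_integrable lborel {a<..<b} (\<lambda>x. (u x)\<^sup>2)"
  by (simp add: L2_def)

lemma continuous_L2: "continuous_on {a..b} u \<Longrightarrow> u \<in> L2 a b"
  by (intro L2_I set_integrable_borel continuous_integrable continuous_intros)

lemma L2_mult:
  assumes "u \<in> L2 a b" "v \<in> L2 a b"
  shows "set_integrable lborel {a<..<b} (\<lambda>x. u x * v x)"
proof -
  have "\<bar>u x * v x\<bar> \<le> (u x)\<^sup>2 + (v x)\<^sup>2" for x
  proof -
    have "2 * (\<bar>u x\<bar> * \<bar>v x\<bar>) \<le> (u x)\<^sup>2 + (v x)\<^sup>2" "0 \<le> \<bar>u x\<bar> * \<bar>v x\<bar>"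
      using sum_squares_bound[of "\<bar>u x\<bar>" "\<bar>v x\<bar>"] by (auto simp: algebra_simps)
    then show ?thesis by (simp only: abs_mult)
  qed
  then show ?thesis
    using assms by (intro set_integrable_bound[OF set_integral_add(1)[OF L2_square[of u] L2_square[of v]]])
      (auto intro!: set_borel_measurable_mult[OF L2_borel L2_borel])
qed

lemma L2_integrable: "u \<in> L2 a b \<Longrightarrow> set_integrable lborel {a<..<b} u"
  using L2_mult[of u a b "\<lambda>x. 1"] continuous_L2[of a b "\<lambda>x. 1"] by simp

lemma L2_lincomb:
  assumes "u \<in> L2 a b" "v \<in> L2 a b"
  shows "(\<lambda>x. p * u x + q * v x) \<in> L2 a b"
proof (rule L2_I)
  show "set_borel_measurable lborel {a<..<b} (\<lambda>x. p * u x + q * v x)"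
    using assms by (intro set_borel_measurable_lincomb L2_borel)
  have "set_integrable lborel {a<..<b} (\<lambda>x. p\<^sup>2 * (u x)\<^sup>2 + (2 * p * q) * (u x * v x) + q\<^sup>2 * (v x)\<^sup>2)"
    using assms by (intro set_integral_add(1) set_integrable_mult_right L2_mult L2_square)
  then show "set_integrable lborel {a<..<b} (\<lambda>x. (p * u x + q * v x)\<^sup>2)"
    by (simp add: power2_eq_square algebra_simps)
qed

lemma L2_cmult: "u \<in> L2 a b \<Longrightarrow> (\<lambda>x. p * u x) \<in> L2 a b"
  using L2_lincomb[of u a b u p 0] by simp

lemma L2_diff: "u \<in> L2 a b \<Longrightarrow> v \<in> L2 a b \<Longrightarrow> (\<lambda>x. u x - v x) \<in> L2 a b"
  using L2_lincomb[of u a b v 1 "-1"] by simp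

lemma L2_add: "u \<in> L2 a b \<Longrightarrow> v \<in> L2 a b \<Longrightarrow> (\<lambda>x. u x + v x) \<in> L2 a b"
  using L2_lincomb[of u a b v 1 1] by simp

lemma L2_sum: "(\<And>i. i \<in> I \<Longrightarrow> u i \<in> L2 a b) \<Longrightarrow> (\<lambda>x. \<Sum>i\<in>I. u i x) \<in> L2 a b"
  by (induction I rule: infinite_finite_induct) (auto intro: L2_add continuous_L2)

lemma L2_subset:
  assumes "u \<in> L2 a b" "a \<le> c" "d \<le> b"
  shows "u \<in> L2 c d"
proof (rule L2_I)
  show "set_borel_measurable lborel {c<..<d} u"
    using assms by (intro set_borel_measurable_subset[OF L2_borel[OF assms(1)]]) auto
  show "set_integrable lborel {c<..<d} (\<lambda>x. (u x)\<^sup>2)"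
    using assms by (intro set_integrable_subset[OF L2_square[OF assms(1)]]) auto
qed

lemma set_integral_nonneg_real:
  fixes f :: "real \<Rightarrow> real"
  shows "(\<And>x. x \<in> A \<Longrightarrow> 0 \<le> f x) \<Longrightarrow> 0 \<le> (LINT x:A|M. f x)"
  unfolding set_lebesgue_integral_def
  by (rule integral_nonneg_AE) (auto simp: indicator_def)

lemma square_le_of_quadratic_nonneg:
  fixes A B C :: real
  assumes "\<And>t. 0 \<le> A * t\<^sup>2 + 2 * B * t + C" and "0 \<le> A"
  shows "B\<^sup>2 \<le> A * C"
proof (cases "A = 0")
  case True
  have "B = 0"
  proof (rule ccontr)
    assume "B \<noteq> 0"
    then have "2 * B * (- (C + 1) / (2 * B)) = - (C + 1)" by simp
    with assms(1)[of "- (C + 1) / (2 * B)"] True show False by simp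
  qed
  then show ?thesis using True by simp
next
  case False
  then have "A > 0" using assms by simp
  have "0 \<le> A * (A * (- B / A)\<^sup>2 + 2 * B * (- B / A) + C)"
    using assms by (intro mult_nonneg_nonneg)
  also have "\<dots> = A * C - B\<^sup>2" using \<open>A > 0\<close> by (simp add: right_diff_distrib power2_eq_square)
  finally show ?thesis by simp
qed

lemma L2_Cauchy_Schwarz:
  assumes "u \<in> L2 a b" "v \<in> L2 a b"
  shows "(LINT x:{a<..<b}|lborel. u x * v x)\<^sup>2
    \<le> (LINT x:{a<..<b}|lborel. (u x)\<^sup>2) * (LINT x:{a<..<b}|lborel. (v x)\<^sup>2)"
proof (rule square_le_of_quadratic_nonneg)
  fix t
  have "0 \<le> (LINT x:{a<..<b}|lborel. (t * u x + v x)\<^sup>2)"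
    by (rule set_integral_nonneg_real) simp
  also have "\<dots> = (LINT x:{a<..<b}|lborel. t\<^sup>2 * (u x)\<^sup>2 + (2 * t) * (u x * v x) + (v x)\<^sup>2)"
    by (simp add: power2_eq_square algebra_simps)
  also have "\<dots> = t\<^sup>2 * (LINT x:{a<..<b}|lborel. (u x)\<^sup>2) + (2 * t) * (LINT x:{a<..<b}|lborel. u x * v x)
      + (LINT x:{a<..<b}|lborel. (v x)\<^sup>2)"
    using assms by (simp add: L2_mult L2_square set_integrable_mult_right)
  finally show "0 \<le> (LINT x:{a<..<b}|lborel. (u x)\<^sup>2) * t\<^sup>2 + 2 * (LINT x:{a<..<b}|lborel. u x * v x) * t
      + (LINT x:{a<..<b}|lborel. (v x)\<^sup>2)" by (simp add: algebra_simps)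
qed (simp add: set_integral_nonneg_real)

section \<open>Primitives\<close>
definition prim :: "real \<Rightarrow> (real \<Rightarrow> real) \<Rightarrow> real \<Rightarrow> real" where
  "prim a g x = (LINT t:{a<..<x}|lborel. g t)"

lemma prim_start [simp]: "prim a g a = 0"
  by (simp add: prim_def set_lebesgue_integral_def)

lemma Ioo_integrable_subset:
  "set_integrable lborel {a<..<b} g \<Longrightarrow> a \<le> c \<Longrightarrow> d \<le> b \<Longrightarrow> set_integrable lborel {c<..<d} (g :: real \<Rightarrow> real)"
  by (rule set_integrable_subset) auto

lemma Ioo_integral_eq:
  assumes "set_integrable lborel {a<..<b} g" "a \<le> c" "d \<le> b"
  shows "(LINT x:{c<..<d}|lborel. g x) = integral {c..d} (g :: real \<Rightarrow> real)"
  using set_borel_integral_eq_integral(2)[OF Ioo_integrable_subset[OF assms]]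
  by (simp add: integral_open_interval_real)

lemma Icc_integrable_on:
  assumes "set_integrable lborel {a<..<b} g"
  shows "(g :: real \<Rightarrow> real) integrable_on {a..b}"
  using set_borel_integral_eq_integral(1)[OF assms] by (simp add: integrable_on_open_interval_real)

lemma prim_continuous:
  assumes "set_integrable lborel {a<..<b} g"
  shows "continuous_on {a..b} (prim a g)"
  using indefinite_integral_continuous_1[OF Icc_integrable_on[OF assms]]
  by (rule continuous_on_eq) (use assms in \<open>auto simp: prim_def Ioo_integral_eq\<close>)

lemma prim_diff:
  assumes "set_integrable lborel {a<..<b} g" "a \<le> c" "c \<le> d" "d \<le> b"
  shows "prim a g d - prim a g c = (LINT x:{c<..<d}|lborel. g x)"
proof -
  have "g integrable_on {a..d}"
    using Icc_integrable_on[OF Ioo_integrable_subset[OF assms(1), of a d]] assms by auto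
  then have "integral {a..c} g + integral {c..d} g = integral {a..d} g"
    using assms by (intro Henstock_Kurzweil_Integration.integral_combine) auto
  then show ?thesis using assms by (simp add: prim_def Ioo_integral_eq[OF assms(1)])
qed

lemma prim_FTC:
  assumes "a \<le> b" "\<And>x. x \<in> {a..b} \<Longrightarrow> (F has_real_derivative f x) (at x within {a..b})"
    "continuous_on {a..b} f" "x \<in> {a..b}"
  shows "prim a f x = F x - F a"
proof -
  have "(f has_integral F x - F a) {a..x}"
    using assms by (intro fundamental_theorem_of_calculus)
      (auto simp: has_real_derivative_iff_has_vector_derivative[symmetric] intro: DERIV_subset[of F _ _ "{a..b}"])
  then show ?thesis
    using assms Ioo_integral_eq[OF continuous_integrable[OF assms(3)], of a x]
    by (simp add: prim_def integral_unique)
qed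

section \<open>The fundamental lemma and the lemma of du Bois-Reymond\<close>

text \<open>
  The sets over which \<open>w\<close> integrates to zero form a Dynkin system; a vanishing primitive puts all
  half-lines into it, hence all Borel sets, and \<open>w\<close> must be null.
\<close>
lemma AE_zero_of_prim_zero:
  assumes w: "set_integrable lborel {a<..<b} w" and "\<And>x. x \<in> {a<..<b} \<Longrightarrow> prim a w x = 0"
  shows "AE x\<in>{a<..<b} in lborel. w x = 0"
proof (cases "a < b")
  case True
  define f where "f x = indicator {a<..<b} x *\<^sub>R w x" for x
  have f: "integrable lborel f" using w by (simp add: f_def[abs_def] set_integrable_def)
  have fs: "set_integrable lborel A f" if "A \<in> sets borel" for A
    using f that unfolding set_integrable_def by (intro integrable_mult_indicator) auto
  have total: "prim a w b = 0"
  proof -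
    have "continuous_on {a..b} (prim a w)" by (rule prim_continuous[OF w])
    then have "(prim a w \<longlongrightarrow> prim a w b) (at_left b)"
      using True by (simp add: continuous_on_Icc_at_leftD)
    moreover have "(prim a w \<longlongrightarrow> 0) (at_left b)"
      using eventually_at_left_real[OF True] by (intro tendsto_eventually) (auto intro: eventually_mono simp: assms)
    ultimately show ?thesis by (rule tendsto_unique[rotated]) auto
  qed
  have ray: "(LINT x:{..y}|lborel. f x) = 0" for y
  proof -
    have "(LINT x:{..y}|lborel. f x) = (LINT x:{a<..min y b}|lborel. f x)"
      unfolding set_lebesgue_integral_def f_def by (rule Bochner_Integration.integral_cong) (auto simp: indicator_def)
    also have "\<dots> = (LINT x:{a<..<min y b}|lborel. f x)"
      by (rule set_integral_cong_set)
        (use AE_lborel_singleton[of "min y b"] in \<open>auto intro!: set_integrable_borel fs intro: eventually_mono\<close>)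
    also have "\<dots> = prim a w (min y b)"
      unfolding prim_def set_lebesgue_integral_def f_def by (rule Bochner_Integration.integral_cong) (auto simp: indicator_def)
    also have "\<dots> = 0"
    proof -
      consider "min y b \<le> a" | "a < min y b" "min y b < b" | "min y b = b" by linarith
      then show ?thesis
        using assms(2)[of "min y b"] total by cases (auto simp: prim_def set_lebesgue_integral_def)
    qed
    finally show ?thesis .
  qed
  have UNIV: "(LINT x:UNIV|lborel. f x) = 0"
    using total unfolding prim_def f_def set_lebesgue_integral_def by simp
  have stable: "Int_stable (range (\<lambda>y::real. {..y}))" and closed: "range (\<lambda>y::real. {..y}) \<subseteq> Pow UNIV"
    by (auto simp: Int_stable_def)
  have "(LINT x:A|lborel. f x) = 0" if "A \<in> sigma_sets UNIV (range (\<lambda>y::real. {..y}))" for A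
    using stable closed that
  proof (induction rule: sigma_sets_induct_disjoint)
    case (compl A)
    have A: "A \<in> sets borel" using compl(1) by (simp add: borel_eq_atMost sets_measure_of)
    have "(LINT x:A \<union> (UNIV - A)|lborel. f x) = (LINT x:A|lborel. f x) + (LINT x:UNIV - A|lborel. f x)"
      using A by (intro set_integral_Un fs) auto
    then show ?case using UNIV compl by simp
  next
    case (union A)
    have A: "A i \<in> sets borel" for i using union(2) by (auto simp: borel_eq_atMost sets_measure_of)
    have "(LINT x:(\<Union>i. A i)|lborel. f x) = (\<Sum>i. (LINT x:A i|lborel. f x))"
      using A union(1) by (intro lebesgue_integral_countable_add fs) (auto simp: disjoint_family_on_def)
    then show ?case using union by simp
  next
    case basic
    then show ?case using ray by auto
  next
    case empty
    then show ?case by (simp add: set_lebesgue_integral_def)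
  qed
  then have "AE x in lborel. f x = 0"
    using f by (intro density_unique_real) (auto simp: borel_eq_atMost sets_measure_of)
  then show ?thesis by (rule AE_mp) (auto simp: f_def)
qed auto

text \<open>
  Dominated convergence along \<open>plateau c d k\<close> shows that \<open>w\<close> has integral zero over every interval
  compactly contained in \<open>(a,b)\<close>, so its primitive is constant, with the value 0 of its limit at \<open>a\<close>.
\<close>
lemma fundamental_lemma:
  assumes w: "set_integrable lborel {a<..<b} w"
    and "\<And>\<phi>. \<phi> \<in> test_functions a b \<Longrightarrow> (LINT x:{a<..<b}|lborel. w x * \<phi> x) = 0"
  shows "AE x\<in>{a<..<b} in lborel. w x = 0"
proof (rule AE_zero_of_prim_zero[OF w])
  have zero: "(LINT x:{c<..<d}|lborel. w x) = 0" if "a < c" "c < d" "d < b" for c d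
  proof -
    have "(\<lambda>k. LINT x:{a<..<b}|lborel. w x * plateau c d k x) \<longlonglongrightarrow> (LINT x:{a<..<b}|lborel. w x * indicator {c<..<d} x)"
      unfolding set_lebesgue_integral_def
    proof (rule integral_dominated_convergence[where w = "\<lambda>x. \<bar>indicator {a<..<b} x *\<^sub>R w x\<bar>"])
      have *: "set_borel_measurable lborel {a<..<b} w" by (rule set_integrable_borel[OF w])
      show "(\<lambda>x. indicat_real {a<..<b} x *\<^sub>R (w x * indicat_real {c<..<d} x)) \<in> borel_measurable lborel"
        using * unfolding set_borel_measurable_def by (auto simp: mult.assoc[symmetric])
      have [measurable]: "plateau c d k \<in> borel_measurable borel" for k
        using plateau_test[OF that(1,3)] by (auto intro!: borel_measurable_continuous_onI test_continuous)
      show "(\<lambda>x. indicat_real {a<..<b} x *\<^sub>R (w x * plateau c d k x)) \<in> borel_measurable lborel" for k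
        using * unfolding set_borel_measurable_def by (auto simp: mult.assoc[symmetric])
      show "integrable lborel (\<lambda>x. \<bar>indicator {a<..<b} x *\<^sub>R w x\<bar>)"
        using w unfolding set_integrable_def by (rule integrable_abs)
      show "AE x in lborel. (\<lambda>k. indicat_real {a<..<b} x *\<^sub>R (w x * plateau c d k x)) \<longlonglongrightarrow> indicat_real {a<..<b} x *\<^sub>R (w x * indicat_real {c<..<d} x)"
        by (intro always_eventually allI tendsto_intros plateau_tendsto)
      show "AE x in lborel. norm (indicat_real {a<..<b} x *\<^sub>R (w x * plateau c d k x)) \<le> \<bar>indicat_real {a<..<b} x *\<^sub>R w x\<bar>" for k
        using plateau_bounds[of c d k] by (auto simp: abs_mult indicator_def intro!: mult_left_le)
    qed
    then have "(LINT x:{a<..<b}|lborel. w x * indicator {c<..<d} x) = 0"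
      using assms(2)[OF plateau_test[OF that(1,3)]] by (simp add: LIMSEQ_const_iff)
    moreover have "(LINT x:{a<..<b}|lborel. w x * indicator {c<..<d} x) = (LINT x:{c<..<d}|lborel. w x)"
      unfolding set_lebesgue_integral_def using that by (intro Bochner_Integration.integral_cong) (auto simp: indicator_def)
    ultimately show ?thesis by simp
  qed
  fix x assume x: "x \<in> {a<..<b}"
  have "continuous_on {a..b} (prim a w)" by (rule prim_continuous[OF w])
  then have "(prim a w \<longlongrightarrow> prim a w a) (at_right a)"
    using x by (intro continuous_on_Icc_at_rightD[of a b]) auto
  moreover have "\<forall>\<^sub>F y in at_right a. prim a w y = prim a w x"
  proof -
    have "\<forall>\<^sub>F y in at_right a. y \<in> {a<..<x}" using x by (intro eventually_at_right_real) auto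
    then show ?thesis
    proof eventually_elim
      case (elim y)
      then show ?case using prim_diff[OF w, of y x] zero[of y x] x by auto
    qed
  qed
  ultimately show "prim a w x = 0"
    using tendsto_eventually tendsto_unique trivial_limit_at_right_real prim_start by metis
qed

lemma test_integrable: "\<phi> \<in> test_functions a b \<Longrightarrow> set_integrable lborel {c<..<d} \<phi>"
  by (intro continuous_integrable test_continuous)

lemma integrable_times_continuous:
  fixes G g :: "real \<Rightarrow> real"
  assumes "set_integrable lborel {a<..<b} g" "continuous_on {a..b} G"
  shows "set_integrable lborel {a<..<b} (\<lambda>x. g x * G x)"
  using continuous_bounded_integrable[OF assms(2,1)] by (simp add: mult.commute)

text \<open>
  A classical antiderivative of \<open>\<psi>\<close> is constant to the left and to the right of the support of \<open>\<psi>\<close>;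
  the zero mean makes the two constants agree, so the antiderivative is again a test function.
\<close>
lemma test_antiderivative:
  assumes "a < b" "\<psi> \<in> test_functions a b" "(LINT x:{a<..<b}|lborel. \<psi> x) = 0"
  obtains \<Psi> where "\<Psi> \<in> test_functions a b" "deriv \<Psi> = \<psi>"
proof -
  obtain K where K: "compact K" "K \<subseteq> {a<..<b}" "\<And>x. x \<notin> K \<Longrightarrow> \<psi> x = 0"
    using assms(2) by (auto simp: test_functions_def)
  obtain c d where cd: "a < c" "c \<le> d" "d < b" "K \<subseteq> {c..d}"
  proof (cases "K = {}")
    case True
    with that[of "(a + b) / 2" "(a + b) / 2"] assms(1) show ?thesis by (auto simp: field_simps)
  next
    case False
    obtain c d where "c \<in> K" "\<And>x. x \<in> K \<Longrightarrow> c \<le> x" "d \<in> K" "\<And>x. x \<in> K \<Longrightarrow> x \<le> d"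
      using compact_attains_inf[OF K(1) False] compact_attains_sup[OF K(1) False] by metis
    with K(2) that[of c d] show ?thesis by (auto simp: subset_eq)
  qed
  have "isCont \<psi> x" for x using test_DERIV[OF assms(2)] DERIV_isCont by blast
  then obtain F0 where F0: "\<And>x. (F0 has_real_derivative \<psi> x) (at x)"
    using einterval_antiderivative[of "-\<infinity>" "\<infinity>" \<psi>]
    by (auto simp: has_real_derivative_iff_has_vector_derivative)
  define \<Psi> where "\<Psi> x = F0 x - F0 a" for x
  have D: "(\<Psi> has_real_derivative \<psi> x) (at x)" for x
    unfolding \<Psi>_def by (auto intro!: derivative_eq_intros F0)
  have b: "\<Psi> b = 0"
  proof -
    have "prim a \<psi> b = F0 b - F0 a"
      using assms(1) by (intro prim_FTC[of a b]) (auto intro: F0 has_field_derivative_at_within test_continuous[OF assms(2)])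
    then show ?thesis using assms(3) by (simp add: prim_def \<Psi>_def)
  qed
  have low: "\<Psi> x = \<Psi> a" if "x < c" for x
  proof -
    have "\<exists>C. \<forall>y\<in>{..<c}. \<Psi> y = C"
    proof (rule has_field_derivative_zero_constant)
      show "(\<Psi> has_real_derivative 0) (at y within {..<c})" if "y \<in> {..<c}" for y
        using D[of y] K(3)[of y] cd that by (metis (no_types, lifting) atLeastAtMost_iff has_field_derivative_at_within in_mono leD lessThan_iff)
    qed simp
    then show ?thesis using that cd by force
  qed
  have high: "\<Psi> x = \<Psi> b" if "x > d" for x
  proof -
    have "\<exists>C. \<forall>y\<in>{d<..}. \<Psi> y = C"
    proof (rule has_field_derivative_zero_constant)
      show "(\<Psi> has_real_derivative 0) (at y within {d<..})" if "y \<in> {d<..}" for y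
        using D[of y] K(3)[of y] cd that by (metis (no_types, lifting) atLeastAtMost_iff has_field_derivative_at_within in_mono leD greaterThan_iff)
    qed simp
    then show ?thesis using that cd by force
  qed
  have "\<Psi> x = 0" if "x \<notin> {c..d}" for x
    using low[of x] high[of x] that b by (auto simp: \<Psi>_def)
  moreover have deriv: "deriv \<Psi> = \<psi>" using D by (auto intro: DERIV_imp_deriv)
  moreover have "smooth \<Psi>"
    unfolding smooth_iff_cdiff
  proof
    show "cdiff k \<Psi>" for k
      by (rule cdiff_mono, rule cdiff_SucI[OF D])
        (use assms(2) in \<open>auto simp: test_functions_def smooth_iff_cdiff\<close>)
  qed
  ultimately have "\<Psi> \<in> test_functions a b"
    using cd by (auto simp: test_functions_def intro!: exI[of _ "{c..d}"])
  then show ?thesis using that deriv by blast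
qed

text \<open>
  Subtracting from a test function the right multiple of one fixed bump \<open>\<rho>\<close> leaves a test function
  of mean zero, which is the derivative of a test function.  Hence the fundamental lemma applies
  to \<open>w - c\<close>, where \<open>c\<close> is the \<open>\<rho>\<close>-weighted mean of \<open>w\<close>.
\<close>
lemma du_Bois_Reymond:
  assumes "a < b" and w: "set_integrable lborel {a<..<b} w"
    and zero: "\<And>\<phi>. \<phi> \<in> test_functions a b \<Longrightarrow> (LINT x:{a<..<b}|lborel. w x * deriv \<phi> x) = 0"
  shows "\<exists>c. AE x\<in>{a<..<b} in lborel. w x = c"
proof -
  define \<rho> where "\<rho> = plateau (a + (b - a) / 3) (b - (b - a) / 3) 1"
  have \<rho>: "\<rho> \<in> test_functions a b"
    unfolding \<rho>_def using assms(1) by (intro plateau_test) (auto simp: field_simps)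
  define m where "m = (LINT x:{a<..<b}|lborel. \<rho> x)"
  have "m \<noteq> 0"
  proof
    assume "m = 0"
    then obtain P where P: "P \<in> test_functions a b" "deriv P = \<rho>"
      using test_antiderivative[OF assms(1) \<rho>] by (auto simp: m_def)
    have D: "(P has_real_derivative \<rho> x) (at x)" for x using test_DERIV[OF P(1)] P(2) by metis
    have nn: "0 \<le> \<rho> x" for x by (simp add: \<rho>_def plateau_bounds)
    have le: "P x \<le> P y" if "x \<le> y" for x y
      using DERIV_nonneg_imp_nondecreasing[OF that, of P] D nn by blast
    have "P x = 0" for x
      using le[of x b] le[of a x] le[of b x] le[of x a] test_zero[OF P(1), of a] test_zero[OF P(1), of b] test_zero[OF P(1), of x]
      by (cases "x \<in> {a<..<b}") auto
    then have "P = (\<lambda>x. 0)" by auto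
    then have "\<rho> = (\<lambda>x. 0)" using P(2) by auto
    then have "\<rho> ((a + b) / 2) = 0" by metis
    then show False using assms(1) by (simp add: \<rho>_def plateau_def cutoff_eq field_simps split: if_splits)
  qed
  define c where "c = (LINT x:{a<..<b}|lborel. w x * \<rho> x) / m"
  have "AE x\<in>{a<..<b} in lborel. w x - c = 0"
  proof (rule fundamental_lemma)
    show "set_integrable lborel {a<..<b} (\<lambda>x. w x - c)"
      by (intro set_integral_diff(1) w set_integrable_const)
    fix \<phi> assume \<phi>: "\<phi> \<in> test_functions a b"
    define s where "s = (LINT x:{a<..<b}|lborel. \<phi> x) / m"
    have i: "set_integrable lborel {a<..<b} \<phi>" "set_integrable lborel {a<..<b} \<rho>"
      "set_integrable lborel {a<..<b} (\<lambda>x. w x * \<phi> x)" "set_integrable lborel {a<..<b} (\<lambda>x. w x * \<rho> x)"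
      by (intro test_integrable[OF \<phi>] test_integrable[OF \<rho>] integrable_times_continuous[OF w] test_continuous[OF \<phi>] test_continuous[OF \<rho>])+
    have t: "(\<lambda>x. \<phi> x + (- s) * \<rho> x) \<in> test_functions a b" by (rule test_lincomb[OF \<phi> \<rho>])
    have "(LINT x:{a<..<b}|lborel. \<phi> x + (- s) * \<rho> x) = 0"
    proof (subst set_integral_add(2))
      show "(LINT x:{a<..<b}|lborel. \<phi> x) + (LINT x:{a<..<b}|lborel. (- s) * \<rho> x) = 0"
        using \<open>m \<noteq> 0\<close> unfolding set_integral_mult_right m_def[symmetric] by (simp add: s_def)
    qed (use i in blast)+
    then obtain P where P: "P \<in> test_functions a b" "deriv P = (\<lambda>x. \<phi> x + (- s) * \<rho> x)"
      using test_antiderivative[OF assms(1) t] by metis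
    have "0 = (LINT x:{a<..<b}|lborel. w x * \<phi> x + (- s) * (w x * \<rho> x))"
      using zero[OF P(1)] by (simp add: P(2) algebra_simps)
    also have "\<dots> = (LINT x:{a<..<b}|lborel. w x * \<phi> x) - s * (c * m)"
    proof (subst set_integral_add(2))
      show "(LINT x:{a<..<b}|lborel. w x * \<phi> x) + (LINT x:{a<..<b}|lborel. (- s) * (w x * \<rho> x))
          = (LINT x:{a<..<b}|lborel. w x * \<phi> x) - s * (c * m)"
        using \<open>m \<noteq> 0\<close> unfolding set_integral_mult_right by (simp add: c_def)
    qed (rule i set_integrable_mult_right)+
    finally have "(LINT x:{a<..<b}|lborel. w x * \<phi> x) = c * (LINT x:{a<..<b}|lborel. \<phi> x)"
      using \<open>m \<noteq> 0\<close> by (simp add: s_def)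
    moreover have "(LINT x:{a<..<b}|lborel. (w x - c) * \<phi> x) = (LINT x:{a<..<b}|lborel. w x * \<phi> x - c * \<phi> x)"
      by (simp add: algebra_simps)
    ultimately show "(LINT x:{a<..<b}|lborel. (w x - c) * \<phi> x) = 0"
      using i by (simp add: set_integral_diff(2))
  qed
  then show ?thesis by auto
qed

section \<open>Weak derivatives and primitives\<close>

text \<open>
  For merely integrable \<open>g\<close> and \<open>k\<close> the product rule is Fubini's theorem: the two integrals are those
  of \<open>g(y) k(x)\<close> over the halves \<open>y < x\<close> and \<open>x < y\<close> of the square, and the diagonal is a null set.
\<close>
lemma prim_integration_by_parts:
  assumes "a \<le> b" "set_integrable lborel {a<..<b} g" "set_integrable lborel {a<..<b} k"
  shows "(LINT x:{a<..<b}|lborel. prim a g x * k x) + (LINT x:{a<..<b}|lborel. g x * prim a k x)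
       = prim a g b * prim a k b"
proof -
  define G where "G x = indicator {a<..<b} x *\<^sub>R g x" for x
  define K where "K x = indicator {a<..<b} x *\<^sub>R k x" for x
  have int: "integrable lborel G" "integrable lborel K"
    using assms by (auto simp: G_def[abs_def] K_def[abs_def] set_integrable_def)
  have [measurable]: "G \<in> borel_measurable borel" "K \<in> borel_measurable borel"
    using int by (auto dest!: borel_measurable_integrable)
  have prim: "indicator {a<..<b} x *\<^sub>R prim a g x = indicator {a<..<b} x *\<^sub>R (\<integral>y. indicator {..<x} y * G y \<partial>lborel)"
    "indicator {a<..<b} x *\<^sub>R prim a k x = indicator {a<..<b} x *\<^sub>R (\<integral>y. indicator {..<x} y * K y \<partial>lborel)" for x
    unfolding prim_def set_lebesgue_integral_def G_def K_def
    by (auto simp: indicator_def intro!: Bochner_Integration.integral_cong)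
  have ind_int: "integrable lborel (\<lambda>y. f x y * H y)"
    if "integrable lborel H" "case_prod f \<in> borel_measurable (lborel \<Otimes>\<^sub>M lborel)" "\<And>x y. \<bar>f x y\<bar> \<le> 1" 
    for H :: "real \<Rightarrow> real" and f :: "real \<Rightarrow> real \<Rightarrow> real" and x
  proof (rule Bochner_Integration.integrable_bound[OF that(1)])
    have [measurable]: "H \<in> borel_measurable borel" using that(1) by (auto dest!: borel_measurable_integrable)
    have [measurable]: "(\<lambda>y. f x y) \<in> borel_measurable lborel"
      using measurable_compose[OF measurable_Pair1' that(2), of x] by simp
    show "(\<lambda>y. f x y * H y) \<in> borel_measurable lborel" by measurable
    show "AE y in lborel. norm (f x y * H y) \<le> norm (H y)"
      using that(3) by (auto simp: abs_mult intro!: mult_left_le_one_le)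
  qed
  have pair: "integrable (lborel \<Otimes>\<^sub>M lborel) (\<lambda>(x, y). K x * G y)"
  proof (rule lborel_pair.Fubini_integrable)
    have "(\<integral> y. norm (case (x, y) of (x, y) \<Rightarrow> K x * G y) \<partial>lborel) = norm (K x) * (\<integral>y. norm (G y) \<partial>lborel)" for x
      by (simp add: abs_mult)
    then show "integrable lborel (\<lambda>x. \<integral> y. norm (case (x, y) of (x, y) \<Rightarrow> K x * G y) \<partial>lborel)"
      using int by (auto intro!: integrable_mult_left integrable_norm)
  qed (use int in auto)
  have pair': "integrable (lborel \<Otimes>\<^sub>M lborel) (\<lambda>(x, y). indicator {x<..} y * (K x * G y))"
    by (rule Bochner_Integration.integrable_bound[OF pair]) (auto simp: indicator_def)
  have slice: "integrable lborel (\<lambda>y. indicator {..<x} y * G y)" "integrable lborel (\<lambda>y. indicator {x<..} y * G y)" for x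
    using int by (auto intro!: integrable_real_mult_indicator simp: mult.commute[of "indicator _ _"])
  have "(LINT x:{a<..<b}|lborel. g x * prim a k x) = (\<integral>y. G y * (\<integral>x. indicator {..<y} x * K x \<partial>lborel) \<partial>lborel)"
    unfolding set_lebesgue_integral_def
    by (rule Bochner_Integration.integral_cong) (use prim(2) in \<open>auto simp: G_def indicator_def\<close>)
  also have "\<dots> = (\<integral>y. (\<integral>x. indicator {x<..} y * (K x * G y) \<partial>lborel) \<partial>lborel)"
  proof (rule Bochner_Integration.integral_cong)
    fix y
    have "(\<integral>x. indicator {x<..} y * (K x * G y) \<partial>lborel) = (\<integral>x. G y * (indicator {..<y} x * K x) \<partial>lborel)"
      by (rule Bochner_Integration.integral_cong) (auto simp: indicator_def)
    then show "G y * (\<integral>x. indicator {..<y} x * K x \<partial>lborel) = (\<integral>x. indicator {x<..} y * (K x * G y) \<partial>lborel)" by simp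
  qed simp
  also have "\<dots> = (\<integral>x. (\<integral>y. indicator {x<..} y * (K x * G y) \<partial>lborel) \<partial>lborel)"
    by (rule lborel_pair.Fubini_integral[OF pair'])
  also have "\<dots> = (\<integral>x. K x * (\<integral>y. indicator {x<..} y * G y \<partial>lborel) \<partial>lborel)"
    by (rule Bochner_Integration.integral_cong) (auto simp: mult.left_commute)
  finally have 1: "(LINT x:{a<..<b}|lborel. g x * prim a k x) = (\<integral>x. K x * (\<integral>y. indicator {x<..} y * G y \<partial>lborel) \<partial>lborel)" .
  have 2: "(LINT x:{a<..<b}|lborel. prim a g x * k x) = (\<integral>x. K x * (\<integral>y. indicator {..<x} y * G y \<partial>lborel) \<partial>lborel)"
    unfolding set_lebesgue_integral_def
    by (rule Bochner_Integration.integral_cong) (use prim(1) in \<open>auto simp: K_def indicator_def\<close>)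
  have split: "(\<integral>y. indicator {x<..} y * G y \<partial>lborel) = (\<integral>y. G y \<partial>lborel) - (\<integral>y. indicator {..<x} y * G y \<partial>lborel)" for x
  proof -
    have "(\<integral>y. indicator {..<x} y * G y \<partial>lborel) + (\<integral>y. indicator {x<..} y * G y \<partial>lborel)
        = (\<integral>y. indicator {..<x} y * G y + indicator {x<..} y * G y \<partial>lborel)"
      by (rule Bochner_Integration.integral_add[symmetric, OF slice])
    also have "\<dots> = (\<integral>y. G y \<partial>lborel)"
      by (rule integral_cong_AE) (use AE_lborel_singleton[of x] in \<open>auto simp: indicator_def\<close>)
    finally show ?thesis by simp
  qed
  have "set_integrable lborel {a<..<b} (\<lambda>x. prim a g x * k x)"
    using assms by (intro continuous_bounded_integrable prim_continuous)
  then have intK: "integrable lborel (\<lambda>x. K x * (\<integral>y. indicator {..<x} y * G y \<partial>lborel))"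
    unfolding set_integrable_def
    by (rule Bochner_Integration.integrable_cong[THEN iffD1, rotated -1])
       (use prim(1) in \<open>auto simp: K_def indicator_def\<close>)
  have "prim a g b * prim a k b = (\<integral>x. K x * (\<integral>y. G y \<partial>lborel) \<partial>lborel)"
    unfolding prim_def set_lebesgue_integral_def G_def[symmetric] K_def[symmetric] by simp
  also have "\<dots> = (\<integral>x. K x * (\<integral>y. indicator {..<x} y * G y \<partial>lborel) \<partial>lborel) + (\<integral>x. K x * (\<integral>y. indicator {x<..} y * G y \<partial>lborel) \<partial>lborel)"
    unfolding split right_diff_distrib using intK int by simp
  finally show ?thesis using 1 2 by simp
qed

lemma test_prim:
  assumes "a \<le> b" "\<phi> \<in> test_functions a b" "x \<in> {a..b}"
  shows "prim a (deriv \<phi>) x = \<phi> x"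
  using prim_FTC[OF assms(1), of \<phi> "deriv \<phi>" x] assms test_zero[OF assms(2), of a]
  by (auto intro: has_field_derivative_at_within test_DERIV test_deriv_continuous)

lemma prim_times_test_deriv:
  assumes "a \<le> b" "set_integrable lborel {a<..<b} g" "\<phi> \<in> test_functions a b"
  shows "(LINT x:{a<..<b}|lborel. prim a g x * deriv \<phi> x) = - (LINT x:{a<..<b}|lborel. g x * \<phi> x)"
proof -
  have "(LINT x:{a<..<b}|lborel. g x * prim a (deriv \<phi>) x) = (LINT x:{a<..<b}|lborel. g x * \<phi> x)"
    using test_prim[OF assms(1,3)] by (intro set_lebesgue_integral_cong) auto
  moreover have "prim a (deriv \<phi>) b = 0"
    using test_prim[OF assms(1,3), of b] test_zero[OF assms(3), of b] assms(1) by simp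
  ultimately show ?thesis
    using prim_integration_by_parts[OF assms(1,2) continuous_integrable[OF test_deriv_continuous[OF assms(3)]]]
    by simp
qed

lemma has_weak_deriv_prim:
  assumes "a \<le> b" "g \<in> L2 a b" "set_borel_measurable lborel {a<..<b} u"
    and u: "AE x\<in>{a<..<b} in lborel. u x = c + prim a g x"
  shows "has_weak_deriv a b u g"
  unfolding has_weak_deriv_def
proof (intro conjI ballI assms(2))
  fix \<phi> assume \<phi>: "\<phi> \<in> test_functions a b"
  note g = L2_integrable[OF assms(2)]
  have i: "set_integrable lborel {a<..<b} (deriv \<phi>)" "set_integrable lborel {a<..<b} (\<lambda>x. prim a g x * deriv \<phi> x)"
    by (intro continuous_integrable test_deriv_continuous[OF \<phi>])
       (intro continuous_integrable continuous_on_mult prim_continuous[OF g] test_deriv_continuous[OF \<phi>])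
  have "(LINT x:{a<..<b}|lborel. u x * deriv \<phi> x) = (LINT x:{a<..<b}|lborel. c * deriv \<phi> x + prim a g x * deriv \<phi> x)"
  proof (rule set_integral_cong_AE_borel)
    show "set_borel_measurable lborel {a<..<b} (\<lambda>x. u x * deriv \<phi> x)"
      by (rule set_borel_measurable_mult[OF assms(3) set_integrable_borel[OF i(1)]])
    show "set_borel_measurable lborel {a<..<b} (\<lambda>x. c * deriv \<phi> x + prim a g x * deriv \<phi> x)"
      by (intro set_integrable_borel set_integral_add(1) set_integrable_mult_right i)
    show "AE x\<in>{a<..<b} in lborel. u x * deriv \<phi> x = c * deriv \<phi> x + prim a g x * deriv \<phi> x"
      using u by eventually_elim (simp add: algebra_simps)
  qed
  also have "\<dots> = c * prim a (deriv \<phi>) b + (LINT x:{a<..<b}|lborel. prim a g x * deriv \<phi> x)"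
    using i by (simp add: prim_def set_integrable_mult_right)
  also have "prim a (deriv \<phi>) b = 0"
    using test_prim[OF assms(1) \<phi>, of b] test_zero[OF \<phi>, of b] assms(1) by simp
  finally show "(LINT x:{a<..<b}|lborel. u x * deriv \<phi> x) = - (LINT x:{a<..<b}|lborel. g x * \<phi> x)"
    using prim_times_test_deriv[OF assms(1) g \<phi>] by simp
qed

text \<open>
  Integration by parts shows that \<open>u\<close> minus the primitive of \<open>g\<close> annihilates the derivatives of all
  test functions.
\<close>
lemma has_weak_deriv_imp_prim:
  assumes "a < b" "set_integrable lborel {a<..<b} u" "has_weak_deriv a b u g"
  shows "\<exists>c. AE x\<in>{a<..<b} in lborel. u x = c + prim a g x"
proof -
  have g: "set_integrable lborel {a<..<b} g" using assms(3) by (auto simp: has_weak_deriv_def intro: L2_integrable)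
  have "\<exists>c. AE x\<in>{a<..<b} in lborel. u x - prim a g x = c"
  proof (rule du_Bois_Reymond[OF assms(1)])
    show "set_integrable lborel {a<..<b} (\<lambda>x. u x - prim a g x)"
      by (intro set_integral_diff(1) assms(2) continuous_integrable prim_continuous g)
    fix \<phi> assume \<phi>: "\<phi> \<in> test_functions a b"
    have i: "set_integrable lborel {a<..<b} (\<lambda>x. u x * deriv \<phi> x)" "set_integrable lborel {a<..<b} (\<lambda>x. prim a g x * deriv \<phi> x)"
      by (intro integrable_times_continuous assms(2) test_deriv_continuous[OF \<phi>])
         (intro continuous_integrable continuous_on_mult prim_continuous[OF g] test_deriv_continuous[OF \<phi>])
    have "(LINT x:{a<..<b}|lborel. (u x - prim a g x) * deriv \<phi> x) = (LINT x:{a<..<b}|lborel. u x * deriv \<phi> x) - (LINT x:{a<..<b}|lborel. prim a g x * deriv \<phi> x)"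
      using i by (simp add: left_diff_distrib)
    also have "\<dots> = 0"
      using assms(3) \<phi> prim_times_test_deriv[OF _ g \<phi>] assms(1) by (auto simp: has_weak_deriv_def)
    finally show "(LINT x:{a<..<b}|lborel. (u x - prim a g x) * deriv \<phi> x) = 0" .
  qed
  then obtain c where "AE x\<in>{a<..<b} in lborel. u x - prim a g x = c" ..
  then have "AE x\<in>{a<..<b} in lborel. u x = c + prim a g x" by eventually_elim auto
  then show ?thesis ..
qed

lemma has_weak_deriv_unique:
  assumes "has_weak_deriv a b u g" "has_weak_deriv a b u k"
  shows "AE x\<in>{a<..<b} in lborel. g x = k x"
proof -
  have i: "set_integrable lborel {a<..<b} g" "set_integrable lborel {a<..<b} k"
    using assms by (auto simp: has_weak_deriv_def intro: L2_integrable)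
  have "AE x\<in>{a<..<b} in lborel. g x - k x = 0"
  proof (rule fundamental_lemma)
    show "set_integrable lborel {a<..<b} (\<lambda>x. g x - k x)" using i by (rule set_integral_diff(1))
    fix \<phi> assume \<phi>: "\<phi> \<in> test_functions a b"
    have "(LINT x:{a<..<b}|lborel. g x * \<phi> x) = (LINT x:{a<..<b}|lborel. k x * \<phi> x)"
      using assms \<phi> by (fastforce simp: has_weak_deriv_def)
    then show "(LINT x:{a<..<b}|lborel. (g x - k x) * \<phi> x) = 0"
      using integrable_times_continuous[OF i(1) test_continuous[OF \<phi>]] integrable_times_continuous[OF i(2) test_continuous[OF \<phi>]]
      by (simp add: left_diff_distrib)
  qed
  then show ?thesis by eventually_elim auto
qed

lemma has_weak_deriv_weak_deriv: "has_weak_deriv a b u g \<Longrightarrow> has_weak_deriv a b u (weak_deriv a b u)"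
  unfolding weak_deriv_def by (rule someI[of "has_weak_deriv a b u"])

lemma weak_deriv_L2: "has_weak_deriv a b u g \<Longrightarrow> weak_deriv a b u \<in> L2 a b"
  using has_weak_deriv_weak_deriv has_weak_deriv_def by blast

lemma weak_deriv_eq: "has_weak_deriv a b u g \<Longrightarrow> AE x\<in>{a<..<b} in lborel. weak_deriv a b u x = g x"
  using has_weak_deriv_unique has_weak_deriv_weak_deriv by blast

lemma prim_lincomb:
  assumes "set_integrable lborel {a<..<b} g" "set_integrable lborel {a<..<b} k" "x \<le> b"
  shows "prim a (\<lambda>t. p * g t + q * k t) x = p * prim a g x + q * prim a k x"
  using Ioo_integrable_subset[OF assms(1) order_refl assms(3)] Ioo_integrable_subset[OF assms(2) order_refl assms(3)]
  unfolding prim_def by (simp add: set_integrable_mult_right)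

lemma prim_square_bound:
  assumes "g \<in> L2 a b" "a \<le> x" "x \<le> b"
  shows "(prim a g x)\<^sup>2 \<le> (b - a) * (LINT t:{a<..<b}|lborel. (g t)\<^sup>2)"
proof -
  have "(prim a g x)\<^sup>2 \<le> (LINT t:{a<..<x}|lborel. 1\<^sup>2) * (LINT t:{a<..<x}|lborel. (g t)\<^sup>2)"
    using L2_Cauchy_Schwarz[OF continuous_L2[of a x "\<lambda>_. 1"] L2_subset[OF assms(1) order_refl assms(3)]]
    by (simp add: prim_def)
  also have "(LINT t:{a<..<x}|lborel. 1\<^sup>2) = x - a"
    using set_integral_const_Ioo[of a x 1] assms by simp
  also have "(x - a) * (LINT t:{a<..<x}|lborel. (g t)\<^sup>2) \<le> (b - a) * (LINT t:{a<..<b}|lborel. (g t)\<^sup>2)"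
  proof (rule mult_mono)
    have "0 \<le> (LINT t:{x<..<b}|lborel. (g t)\<^sup>2)" by (rule set_integral_nonneg_real) simp
    then show "(LINT t:{a<..<x}|lborel. (g t)\<^sup>2) \<le> (LINT t:{a<..<b}|lborel. (g t)\<^sup>2)"
      using prim_diff[OF L2_square[OF assms(1)], of x b] assms by (simp add: prim_def)
  qed (use assms in \<open>auto intro: set_integral_nonneg_real\<close>)
  finally show ?thesis .
qed

text \<open>
  A working description of \<open>H\<^sub>0\<^sup>1(a,b)\<close>: \<open>u\<close> is a.e. the primitive of the square-integrable function \<open>g\<close>
  that vanishes at both endpoints.  The derivative is kept as an explicit argument so that the
  chosen representative \<open>weak_deriv\<close> enters only through \<open>zero_primitive_weak_deriv\<close>.
\<close>
definition zero_primitive :: "real \<Rightarrow> real \<Rightarrow> (real \<Rightarrow> real) \<Rightarrow> (real \<Rightarrow> real) \<Rightarrow> bool" where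
  "zero_primitive a b u g \<longleftrightarrow> g \<in> L2 a b \<and> set_borel_measurable lborel {a<..<b} u \<and>
     (AE x\<in>{a<..<b} in lborel. u x = prim a g x) \<and> prim a g b = 0"

lemma zero_primitive_weak_deriv:
  assumes "a \<le> b" "zero_primitive a b u g"
  shows "AE x\<in>{a<..<b} in lborel. weak_deriv a b u x = g x" "weak_deriv a b u \<in> L2 a b"
proof -
  have "has_weak_deriv a b u g"
    using assms by (intro has_weak_deriv_prim[of a b g u 0]) (auto simp: zero_primitive_def)
  then show "AE x\<in>{a<..<b} in lborel. weak_deriv a b u x = g x" "weak_deriv a b u \<in> L2 a b"
    by (rule weak_deriv_eq, rule weak_deriv_L2)
qed

lemma zero_primitive_lincomb:
  assumes "zero_primitive a b u g" "zero_primitive a b v k"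
  shows "zero_primitive a b (\<lambda>x. p * u x + q * v x) (\<lambda>x. p * g x + q * k x)"
proof -
  have gk: "g \<in> L2 a b" "k \<in> L2 a b" using assms by (auto simp: zero_primitive_def)
  note lin = prim_lincomb[OF L2_integrable[OF gk(1)] L2_integrable[OF gk(2)]]
  have "AE x\<in>{a<..<b} in lborel. u x = prim a g x" "AE x\<in>{a<..<b} in lborel. v x = prim a k x"
    using assms by (auto simp: zero_primitive_def)
  then have "AE x\<in>{a<..<b} in lborel. p * u x + q * v x = prim a (\<lambda>x. p * g x + q * k x) x"
    by eventually_elim (simp add: lin)
  then show ?thesis
    using assms by (auto simp: zero_primitive_def lin intro: L2_lincomb set_borel_measurable_lincomb)
qed

text \<open>
  By du Bois-Reymond \<open>u\<close> is \<open>c\<close> plus a primitive of \<open>g\<close>.  If test functions \<open>\<phi>\<^sub>k\<close> converge to \<open>u\<close>, the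
  primitives of \<open>g - \<phi>\<^sub>k'\<close> tend to 0 uniformly, because the \<open>L\<^sup>2\<close> norm of the derivative bounds them.
  At \<open>b\<close> this gives the boundary value, since \<open>\<phi>\<^sub>k(b) = 0\<close>; in the mean it gives \<open>c = 0\<close>, since \<open>u - \<phi>\<^sub>k\<close>
  itself tends to 0 in \<open>L\<^sup>2\<close>.
\<close>
lemma H01_zero_primitive:
  assumes "a < b" "u \<in> H01 a b"
  obtains g where "zero_primitive a b u g"
proof -
  obtain g \<phi> where u: "u \<in> L2 a b" and g: "has_weak_deriv a b u g"
    and \<phi>: "\<And>k::nat. \<phi> k \<in> test_functions a b"
    and lim: "(\<lambda>k. H1_norm a b (\<lambda>x. u x - \<phi> k x)) \<longlonglongrightarrow> 0"
    using assms(2) by (auto simp: H01_def H1_def)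
  have gL: "g \<in> L2 a b" using g by (auto simp: has_weak_deriv_def)
  obtain c where c: "AE x\<in>{a<..<b} in lborel. u x = c + prim a g x"
    using has_weak_deriv_imp_prim[OF assms(1) L2_integrable[OF u] g] by auto
  define d where "d k x = g x - deriv (\<phi> k) x" for k x
  define N where "N k = (H1_norm a b (\<lambda>x. u x - \<phi> k x))\<^sup>2" for k
  have \<phi>L: "\<phi> k \<in> L2 a b" "deriv (\<phi> k) \<in> L2 a b" for k
    by (intro continuous_L2 test_continuous[OF \<phi>] test_deriv_continuous[OF \<phi>])+
  have dL: "d k \<in> L2 a b" for k
    unfolding d_def[abs_def] by (rule L2_diff[OF gL \<phi>L(2)])
  have wL: "(\<lambda>x. u x - \<phi> k x) \<in> L2 a b" for k
    by (rule L2_diff[OF u \<phi>L(1)])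
  have prim_d: "prim a (d k) x = prim a g x - \<phi> k x" if "x \<in> {a..b}" for k x
    using prim_lincomb[OF L2_integrable[OF gL] L2_integrable[OF \<phi>L(2)[of k]], of x 1 "-1"] test_prim[OF _ \<phi>, of x k] that
    by (simp add: d_def[abs_def])
  have w: "AE x\<in>{a<..<b} in lborel. u x - \<phi> k x = c + prim a (d k) x" for k
    using c by eventually_elim (simp add: prim_d)
  have wd: "has_weak_deriv a b (\<lambda>x. u x - \<phi> k x) (d k)" for k
    using assms(1) by (intro has_weak_deriv_prim[OF _ dL _ w] L2_borel wL) simp
  have N: "N k = (LINT x:{a<..<b}|lborel. (u x - \<phi> k x)\<^sup>2) + (LINT x:{a<..<b}|lborel. (d k x)\<^sup>2)" for k
  proof -
    have "(LINT x:{a<..<b}|lborel. (weak_deriv a b (\<lambda>x. u x - \<phi> k x) x)\<^sup>2) = (LINT x:{a<..<b}|lborel. (d k x)\<^sup>2)"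
    proof (rule set_integral_cong_AE_borel)
      show "AE x\<in>{a<..<b} in lborel. (weak_deriv a b (\<lambda>x. u x - \<phi> k x) x)\<^sup>2 = (d k x)\<^sup>2"
        using weak_deriv_eq[OF wd[of k]] by eventually_elim simp
    qed (intro set_integrable_borel L2_square weak_deriv_L2[OF wd] dL)+
    then show ?thesis
      unfolding N_def H1_norm_def
      by (simp add: set_integral_nonneg_real)
  qed
  have N0: "N \<longlonglongrightarrow> 0"
    using tendsto_power[OF lim, of 2] by (simp add: N_def[abs_def])
  have bnd: "(prim a (d k) x)\<^sup>2 \<le> (b - a) * N k" if "x \<in> {a..b}" for k x
  proof -
    have "0 \<le> (LINT x:{a<..<b}|lborel. (u x - \<phi> k x)\<^sup>2)" by (rule set_integral_nonneg_real) simp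
    then have "(LINT x:{a<..<b}|lborel. (d k x)\<^sup>2) \<le> N k" by (simp add: N)
    then have "(b - a) * (LINT x:{a<..<b}|lborel. (d k x)\<^sup>2) \<le> (b - a) * N k"
      using assms(1) by (intro mult_left_mono) auto
    then show ?thesis using prim_square_bound[OF dL, of x k] that by auto
  qed
  have "prim a g b = 0"
  proof -
    have "(prim a g b)\<^sup>2 \<le> (b - a) * N k" for k
      using bnd[of b k] prim_d[of b k] test_zero[OF \<phi>, of b k] assms(1) by simp
    moreover have "(\<lambda>k. (b - a) * N k) \<longlonglongrightarrow> (b - a) * 0" by (intro tendsto_intros N0)
    ultimately have "(prim a g b)\<^sup>2 \<le> (b - a) * 0" by (intro LIMSEQ_le_const) auto
    then show ?thesis by simp
  qed
  moreover have "c = 0"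
  proof -
    have "c\<^sup>2 * (b - a) \<le> 2 * N k + 2 * ((b - a) * N k) * (b - a)" for k
    proof -
      have "c\<^sup>2 * (b - a) = (LINT x:{a<..<b}|lborel. c\<^sup>2)"
        using set_integral_const_Ioo[of a b "c\<^sup>2"] assms(1) by simp
      also have "\<dots> \<le> (LINT x:{a<..<b}|lborel. 2 * (u x - \<phi> k x)\<^sup>2 + 2 * ((b - a) * N k))"
      proof (rule set_integral_mono_AE)
        show "AE x\<in>{a<..<b} in lborel. c\<^sup>2 \<le> 2 * (u x - \<phi> k x)\<^sup>2 + 2 * ((b - a) * N k)"
          using w[of k]
        proof eventually_elim
          case (elim x)
          show ?case
          proof
            assume x: "x \<in> {a<..<b}"
            define s t where "s = u x - \<phi> k x" and "t = prim a (d k) x"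
            have c: "c = s - t" using elim x by (simp add: s_def t_def)
            have "c\<^sup>2 + (s + t)\<^sup>2 = 2 * s\<^sup>2 + 2 * t\<^sup>2"
              unfolding c by (simp add: power2_eq_square algebra_simps)
            moreover have "0 \<le> (s + t)\<^sup>2" by simp
            ultimately have "c\<^sup>2 \<le> 2 * s\<^sup>2 + 2 * t\<^sup>2" by linarith
            then show "c\<^sup>2 \<le> 2 * (u x - \<phi> k x)\<^sup>2 + 2 * ((b - a) * N k)"
              using bnd[of x k] x by (simp add: s_def t_def)
          qed
        qed
      qed (intro set_integral_add(1) set_integrable_mult_right L2_square wL set_integrable_const)+
      also have "\<dots> = 2 * (LINT x:{a<..<b}|lborel. (u x - \<phi> k x)\<^sup>2) + 2 * ((b - a) * N k) * (b - a)"
        using L2_square[OF wL] assms(1)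
        by (subst set_integral_add(2)) (auto intro!: set_integrable_const simp: set_integral_const_Ioo)
      also have "(LINT x:{a<..<b}|lborel. (u x - \<phi> k x)\<^sup>2) \<le> N k"
        by (simp add: N set_integral_nonneg_real)
      finally show ?thesis by simp
    qed
    moreover have "(\<lambda>k. 2 * N k + 2 * ((b - a) * N k) * (b - a)) \<longlonglongrightarrow> 2 * 0 + 2 * ((b - a) * 0) * (b - a)"
      by (intro tendsto_intros N0)
    ultimately have "c\<^sup>2 * (b - a) \<le> 2 * 0 + 2 * ((b - a) * 0) * (b - a)"
      by (intro LIMSEQ_le_const) auto
    then show ?thesis using assms(1) by (simp add: mult_le_0_iff)
  qed
  ultimately show ?thesis
    using that[of g] c gL L2_borel[OF u] by (simp add: zero_primitive_def)
qed

lemma prim_has_real_derivative: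
  assumes "continuous_on {a..b} f" "a < x" "x < b"
  shows "(prim a f has_real_derivative f x) (at x)"
proof -
  have "((\<lambda>y. integral {a..y} f) has_real_derivative f x) (at x within {a..b})"
    using assms by (intro integral_has_real_derivative) auto
  then have "((\<lambda>y. integral {a..y} f) has_real_derivative f x) (at x)"
    using assms by (simp add: at_within_Icc_at)
  moreover have "\<forall>\<^sub>F y in nhds x. integral {a..y} f = prim a f y"
    using eventually_nhds_in_open[of "{a<..<b}" x] assms
    by (auto intro: eventually_mono simp: prim_def Ioo_integral_eq[OF continuous_integrable[OF assms(1)]])
  ultimately show ?thesis by (simp add: DERIV_cong_ev)
qed

lemma continuous_AE_zero:
  fixes f :: "real \<Rightarrow> real"
  assumes "a < b" and f: "continuous_on {a..b} f" and zero: "AE x\<in>{a<..<b} in lborel. f x = 0" and "x \<in> {a..b}"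
  shows "f x = 0"
proof -
  have prim0: "prim a f y = 0" if "y \<le> b" for y
  proof -
    have "prim a f y = (LINT t:{a<..<y}|lborel. 0)"
      unfolding prim_def
    proof (rule set_integral_cong_AE_borel)
      show "set_borel_measurable lborel {a<..<y} f"
        by (rule set_integrable_borel[OF Ioo_integrable_subset[OF continuous_integrable[OF f] order_refl that]])
      show "AE x\<in>{a<..<y} in lborel. f x = 0"
        using zero by eventually_elim (use that in auto)
    qed (rule set_integrable_borel[OF set_integrable_const])
    then show ?thesis by simp
  qed
  have "f y = 0" if y: "y \<in> {a<..<b}" for y
  proof -
    have "\<forall>\<^sub>F z in nhds y. z \<in> {a<..<b}" using y by (intro eventually_nhds_in_open) auto
    then have "\<forall>\<^sub>F z in nhds y. prim a f z = 0" by eventually_elim (simp add: prim0)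
    from DERIV_cong_ev[OF refl this refl] have "((\<lambda>_. 0) has_real_derivative f y) (at y)"
      using y prim_has_real_derivative[OF f, of y] by simp
    then show ?thesis by (rule DERIV_unique) (rule DERIV_const)
  qed
  then show ?thesis
    using continuous_constant_on_closure[of "{a<..<b}" f 0 x] f assms(1,4) by simp
qed

section \<open>Poincare inequalities with sharp constant\<close>

text \<open>
  For \<open>V\<close> vanishing at both ends and \<open>q = cot\<close> of an affine function with slope \<open>k\<close>,
  \<open>V'\<^sup>2 - k\<^sup>2 V\<^sup>2 = (V' - k V q)\<^sup>2 + (k V\<^sup>2 q)'\<close>, and the last term integrates to zero.  With \<open>k\<close> slightly
  below \<open>\<pi>/(b - a)\<close> and the argument shifted by \<open>\<delta>\<close>, the cotangent is regular on the closed interval;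
  letting \<open>k\<close> tend to \<open>\<pi>/(b - a)\<close> gives the sharp constant.
\<close>
lemma Dirichlet_Poincare:
  assumes "a < b" and f: "continuous_on {a..b} f" and zero: "prim a f b = 0"
  shows "(pi / (b - a))\<^sup>2 * (LINT x:{a<..<b}|lborel. (prim a f x)\<^sup>2) \<le> (LINT x:{a<..<b}|lborel. (f x)\<^sup>2)"
proof (rule field_le_mult_one_interval)
  fix z :: real assume z: "0 < z" "z < 1"
  define k where "k = sqrt z * (pi / (b - a))"
  define \<delta> where "\<delta> = (pi - k * (b - a)) / 2"
  have k: "k > 0" "k * (b - a) < pi" "k\<^sup>2 = z * (pi / (b - a))\<^sup>2"
    using z assms(1) unfolding k_def power_mult_distrib by auto
  have \<delta>: "\<delta> > 0" using k by (simp add: \<delta>_def)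
  define V where "V = prim a f"
  have V: "continuous_on {a..b} V"
    unfolding V_def by (intro prim_continuous continuous_integrable f)
  have sin: "sin (k * (x - a) + \<delta>) > 0" if "x \<in> {a..b}" for x
  proof (rule sin_gt_zero)
    have "0 \<le> k * (x - a)" using that k by auto
    then show "0 < k * (x - a) + \<delta>" using \<delta> by simp
    have "k * (x - a) \<le> k * (b - a)" using that k by (intro mult_left_mono) auto
    moreover have "k * (b - a) + \<delta> < pi" using k by (simp add: \<delta>_def field_simps)
    ultimately show "k * (x - a) + \<delta> < pi" by linarith
  qed
  define q where "q x = cos (k * (x - a) + \<delta>) / sin (k * (x - a) + \<delta>)" for x
  define H where "H x = prim a (\<lambda>x. (f x)\<^sup>2 - k\<^sup>2 * (V x)\<^sup>2) x - k * ((V x)\<^sup>2 * q x)" for x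
  have cont: "continuous_on {a..b} (\<lambda>x. (f x)\<^sup>2 - k\<^sup>2 * (V x)\<^sup>2)"
    by (intro continuous_intros f V)
  (* H' is the square of f - k V q, so H increases; its boundary values are those of the integral,
     since V vanishes at a and b. *)
  have "H a \<le> H b"
  proof (rule DERIV_nonneg_imp_increasing_open[of a b H])
    show "continuous_on {a..b} H"
      unfolding H_def q_def
      by (intro continuous_intros prim_continuous continuous_integrable[OF cont] V)
        (use sin in force)
    fix x assume x: "a < x" "x < b"
    have s: "sin (k * (x - a) + \<delta>) \<noteq> 0" using sin[of x] x by auto
    have quot: "((- S * k) * S - C * (C * k)) / (S * S) = - k * (1 + (C / S)\<^sup>2)" if "S \<noteq> 0" for S C :: real
      using that by (simp add: field_simps power2_eq_square)
    have dq: "(q has_real_derivative - k * (1 + (q x)\<^sup>2)) (at x)"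
    proof -
      have "((\<lambda>x. cos (k * (x - a) + \<delta>) / sin (k * (x - a) + \<delta>)) has_real_derivative
        ((- sin (k * (x - a) + \<delta>) * k) * sin (k * (x - a) + \<delta>) - cos (k * (x - a) + \<delta>) * (cos (k * (x - a) + \<delta>) * k))
          / (sin (k * (x - a) + \<delta>) * sin (k * (x - a) + \<delta>))) (at x)"
        using s by (auto intro!: derivative_eq_intros)
      then show ?thesis
        unfolding q_def by (rule DERIV_cong) (rule quot[OF s])
    qed
    have dV: "(V has_real_derivative f x) (at x)"
      unfolding V_def by (rule prim_has_real_derivative[OF f x])
    have "(H has_real_derivative (f x)\<^sup>2 - k\<^sup>2 * (V x)\<^sup>2
        - k * (2 * V x * f x * q x + (V x)\<^sup>2 * (- k * (1 + (q x)\<^sup>2)))) (at x)"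
      unfolding H_def
      by (auto intro!: derivative_eq_intros prim_has_real_derivative[OF cont x] dV dq)
    moreover have "(f x)\<^sup>2 - k\<^sup>2 * (V x)\<^sup>2
        - k * (2 * V x * f x * q x + (V x)\<^sup>2 * (- k * (1 + (q x)\<^sup>2))) = (f x - k * V x * q x)\<^sup>2"
      by (simp add: power2_eq_square algebra_simps)
    ultimately show "\<exists>y. (H has_real_derivative y) (at x) \<and> 0 \<le> y"
      by (metis zero_le_power2)
  qed (use assms in auto)
  moreover have "H a = 0" by (simp add: H_def V_def)
  moreover have "H b = (LINT x:{a<..<b}|lborel. (f x)\<^sup>2) - k\<^sup>2 * (LINT x:{a<..<b}|lborel. (V x)\<^sup>2)"
  proof -
    have "prim a (\<lambda>x. (f x)\<^sup>2 - k\<^sup>2 * (V x)\<^sup>2) b = (LINT x:{a<..<b}|lborel. (f x)\<^sup>2) - (LINT x:{a<..<b}|lborel. k\<^sup>2 * (V x)\<^sup>2)"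
      unfolding prim_def by (intro set_integral_diff(2) continuous_integrable continuous_intros f V)
    then show ?thesis using zero by (simp add: H_def V_def)
  qed
  ultimately show "z * ((pi / (b - a))\<^sup>2 * (LINT x:{a<..<b}|lborel. (prim a f x)\<^sup>2)) \<le> (LINT x:{a<..<b}|lborel. (f x)\<^sup>2)"
    unfolding k(3) V_def by (simp add: mult.assoc)
qed

text \<open>
  The mean-free part \<open>f\<close> of \<open>u\<close> has a primitive \<open>V\<close> that vanishes at both ends.  Then
  \<open>\<integral> f\<^sup>2 = - \<integral> g V\<close> is at most \<open>\<parallel>g\<parallel> \<parallel>V\<parallel>\<close>, and the inequality for functions vanishing at both
  ends bounds \<open>\<parallel>V\<parallel>\<close> by \<open>(b - a)/\<pi>\<close> times \<open>\<parallel>f\<parallel>\<close>.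
\<close>
lemma Poincare_Wirtinger:
  assumes "a < b" and g: "g \<in> L2 a b" and u: "\<And>x. x \<in> {a..b} \<Longrightarrow> u x = c + prim a g x"
  shows "(LINT x:{a<..<b}|lborel. (u x)\<^sup>2)
    \<le> ((b - a) / pi)\<^sup>2 * (LINT x:{a<..<b}|lborel. (g x)\<^sup>2) + (LINT x:{a<..<b}|lborel. u x)\<^sup>2 / (b - a)"
proof -
  note gi = L2_integrable[OF g]
  have uc: "continuous_on {a..b} u"
  proof (rule continuous_on_eq)
    show "continuous_on {a..b} (\<lambda>x. c + prim a g x)"
      by (intro continuous_intros prim_continuous gi)
  qed (simp add: u)
  note ui = continuous_integrable[OF uc]
  define m where "m = (LINT x:{a<..<b}|lborel. u x) / (b - a)"
  define f where "f x = u x - m" for x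
  have fc: "continuous_on {a..b} f" unfolding f_def by (intro continuous_intros uc)
  note fi = continuous_integrable[OF fc]
  define V where "V = prim a f"
  have f0: "prim a f b = 0"
    using ui assms(1) unfolding prim_def f_def
    by (simp add: set_integral_diff(2) set_integrable_const set_integral_const_Ioo m_def)
  have Vc: "continuous_on {a..b} V" unfolding V_def by (rule prim_continuous[OF fi])
  define F P G where "F = (LINT x:{a<..<b}|lborel. (f x)\<^sup>2)"
    and "P = (LINT x:{a<..<b}|lborel. (V x)\<^sup>2)" and "G = (LINT x:{a<..<b}|lborel. (g x)\<^sup>2)"
  have nn: "0 \<le> F" "0 \<le> P" "0 \<le> G"
    by (auto simp: F_def P_def G_def intro!: set_integral_nonneg_real)
  have "F = (LINT x:{a<..<b}|lborel. prim a g x * f x + (c - m) * f x)"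
    unfolding F_def
  proof (rule set_lebesgue_integral_cong)
    show "\<forall>x. x \<in> {a<..<b} \<longrightarrow> (f x)\<^sup>2 = prim a g x * f x + (c - m) * f x"
      using u by (auto simp: f_def power2_eq_square algebra_simps)
  qed simp
  also have "\<dots> = (LINT x:{a<..<b}|lborel. prim a g x * f x) + (c - m) * prim a f b"
    unfolding prim_def[of a f] set_integral_mult_right[symmetric]
    by (intro set_integral_add(2) set_integrable_mult_right fi continuous_bounded_integrable prim_continuous[OF gi])
  also have "\<dots> = - (LINT x:{a<..<b}|lborel. g x * V x)"
    using prim_integration_by_parts[OF _ gi fi] assms(1) f0 by (simp add: V_def)
  finally have "F\<^sup>2 = (LINT x:{a<..<b}|lborel. g x * V x)\<^sup>2" by simp
  also have "\<dots> \<le> G * P"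
    unfolding G_def P_def by (rule L2_Cauchy_Schwarz[OF g continuous_L2[OF Vc]])
  also have "\<dots> \<le> G * (((b - a) / pi)\<^sup>2 * F)"
  proof (intro mult_left_mono nn)
    have "(pi / (b - a))\<^sup>2 * P \<le> F"
      unfolding P_def F_def V_def by (rule Dirichlet_Poincare[OF assms(1) fc f0])
    then have "((b - a) / pi)\<^sup>2 * ((pi / (b - a))\<^sup>2 * P) \<le> ((b - a) / pi)\<^sup>2 * F"
      by (intro mult_left_mono) auto
    then show "P \<le> ((b - a) / pi)\<^sup>2 * F"
      using assms(1) by (simp add: power_divide)
  qed
  finally have "F * F \<le> F * (((b - a) / pi)\<^sup>2 * G)" by (simp add: power2_eq_square mult_ac)
  then have "F \<le> ((b - a) / pi)\<^sup>2 * G"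
    using nn by (cases "F = 0") (auto simp: mult_le_cancel_left)
  moreover have "F = (LINT x:{a<..<b}|lborel. (u x)\<^sup>2) - (LINT x:{a<..<b}|lborel. u x)\<^sup>2 / (b - a)"
  proof -
    have "F = (LINT x:{a<..<b}|lborel. ((u x)\<^sup>2 - (2 * m) * u x) + m\<^sup>2)"
      unfolding F_def f_def by (simp add: power2_eq_square algebra_simps)
    also have "\<dots> = ((LINT x:{a<..<b}|lborel. (u x)\<^sup>2) - (LINT x:{a<..<b}|lborel. (2 * m) * u x)) + (LINT x:{a<..<b}|lborel. m\<^sup>2)"
    proof -
      have i: "set_integrable lborel {a<..<b} (\<lambda>x. (u x)\<^sup>2)" "set_integrable lborel {a<..<b} (\<lambda>x. (2 * m) * u x)"
        "set_integrable lborel {a<..<b} (\<lambda>x. m\<^sup>2)"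
        by (intro continuous_integrable continuous_intros uc)+
      show ?thesis
        by (subst set_integral_add(2)[OF set_integral_diff(1)[OF i(1,2)] i(3)], subst set_integral_diff(2)[OF i(1,2)]) simp
    qed
    also have "\<dots> = (LINT x:{a<..<b}|lborel. (u x)\<^sup>2) - (2 * m) * (m * (b - a)) + m\<^sup>2 * (b - a)"
      using assms(1) by (simp add: set_integral_const_Ioo m_def)
    also have "\<dots> = (LINT x:{a<..<b}|lborel. (u x)\<^sup>2) - (LINT x:{a<..<b}|lborel. u x)\<^sup>2 / (b - a)"
    proof -
      have "m\<^sup>2 * (b - a) = (LINT x:{a<..<b}|lborel. u x)\<^sup>2 / (b - a)"
        using assms(1) by (simp add: m_def power_divide power2_eq_square)
      moreover have "(2 * m) * (m * (b - a)) = 2 * (m\<^sup>2 * (b - a))" by (simp add: power2_eq_square)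
      ultimately show ?thesis by linarith
    qed
    finally show ?thesis .
  qed
  ultimately show ?thesis by (simp add: G_def)
qed

section \<open>Derivatives of the discrete functions\<close>
lemma mesh_pos: "n > 0 \<Longrightarrow> mesh n > 0" by (simp add: mesh_def)
lemma node_0 [simp]: "node n 0 = 0" by (simp add: node_def)
lemma node_end: "n > 0 \<Longrightarrow> node n n = 1" by (simp add: node_def mesh_def)
lemma node_mono: "i \<le> j \<Longrightarrow> node n i \<le> node n j"
  by (simp add: node_def mesh_def divide_right_mono)
lemma node_nonneg: "0 \<le> node n i" by (simp add: node_def mesh_def)
lemma node_le_1: "n > 0 \<Longrightarrow> i \<le> n \<Longrightarrow> node n i \<le> 1"
  using node_mono[of i n n] node_end[of n] by simp
lemma node_pred: "i > 0 \<Longrightarrow> node n i = node n (i - 1) + mesh n"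
  by (cases i) (simp_all add: node_def algebra_simps)

lemma mesh_integral_sum:
  fixes f :: "real \<Rightarrow> real"
  assumes "n > 0" "set_integrable lborel {0<..<1} f"
  shows "(LINT x:{0<..<1}|lborel. f x) = (\<Sum>i=1..n. LINT x:{node n (i - 1)<..<node n i}|lborel. f x)"
proof -
  have "prim 0 f (node n k) = (\<Sum>i=1..k. LINT x:{node n (i - 1)<..<node n i}|lborel. f x)" if "k \<le> n" for k
    using that
  proof (induction k)
    case (Suc k)
    have "prim 0 f (node n (Suc k)) - prim 0 f (node n k) = (LINT x:{node n k<..<node n (Suc k)}|lborel. f x)"
      using Suc.prems assms by (intro prim_diff[of 0 1]) (auto simp: node_nonneg node_le_1 intro: node_mono)
    then show ?case using Suc by simp
  qed simp
  from this[of n] show ?thesis using node_end[OF assms(1)] by (simp add: prim_def)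
qed

text \<open>
  The derivative of the function that rises linearly from 0 to \<open>h\<close> over the \<open>i\<close>-th cell and carries
  \<open>h\<close> times the bubble there; \<open>\<beta>\<close> stands for the derivative of the bubble profile.
\<close>
definition elem_deriv :: "nat \<Rightarrow> (real \<Rightarrow> real) \<Rightarrow> nat \<Rightarrow> real \<Rightarrow> real" where
  "elem_deriv n \<beta> i x =
     (if x \<in> {node n (i - 1)<..<node n i} then 1 + mesh n * \<beta> (x - node n (i - 1)) else 0)"

text \<open>
  All test functions are primitives of \<open>mesh_deriv n \<beta> d\<close> with slopes \<open>d\<close> summing to zero; taking
  \<open>\<beta> = 0\<close> gives the trial functions.
\<close>
definition mesh_deriv :: "nat \<Rightarrow> (real \<Rightarrow> real) \<Rightarrow> (nat \<Rightarrow> real) \<Rightarrow> real \<Rightarrow> real" where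
  "mesh_deriv n \<beta> d x = (\<Sum>i=1..n. d i * elem_deriv n \<beta> i x)"

lemma mesh_deriv_on_element:
  assumes "i \<in> {1..n}" "x \<in> {node n (i - 1)<..<node n i}"
  shows "mesh_deriv n \<beta> d x = d i * (1 + mesh n * \<beta> (x - node n (i - 1)))"
proof -
  have "elem_deriv n \<beta> k x = 0" if "k \<in> {1..n}" "k \<noteq> i" for k
  proof (cases "k < i")
    case True
    then have "node n k \<le> node n (i - 1)" by (intro node_mono) auto
    then show ?thesis using assms by (auto simp: elem_deriv_def)
  next
    case False
    then have "node n i \<le> node n (k - 1)" using that by (intro node_mono) auto
    then show ?thesis using assms by (auto simp: elem_deriv_def)
  qed
  then have "mesh_deriv n \<beta> d x = (\<Sum>k=1..n. if k = i then d i * elem_deriv n \<beta> i x else 0)"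
    unfolding mesh_deriv_def by (intro sum.cong) auto
  also have "\<dots> = d i * elem_deriv n \<beta> i x" using assms(1) by simp
  also have "elem_deriv n \<beta> i x = 1 + mesh n * \<beta> (x - node n (i - 1))"
    using assms(2) by (simp add: elem_deriv_def)
  finally show ?thesis .
qed

lemma set_integral_shift:
  fixes g :: "real \<Rightarrow> real"
  shows "(LINT x:{s + c<..<s + d}|lborel. g (x - s)) = (LINT x:{c<..<d}|lborel. g x)"
proof -
  have "(LINT x:{c<..<d}|lborel. g x) = (\<integral>x. indicator {c<..<d} (- s + 1 * x) *\<^sub>R g (- s + 1 * x) \<partial>lborel)"
    unfolding set_lebesgue_integral_def by (subst lborel_integral_real_affine[of 1 _ "- s"]) auto
  also have "\<dots> = (LINT x:{s + c<..<s + d}|lborel. g (x - s))"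
    unfolding set_lebesgue_integral_def
    by (rule Bochner_Integration.integral_cong) (auto simp: indicator_def algebra_simps)
  finally show ?thesis by simp
qed

lemma L2_shift:
  assumes "g \<in> L2 c d"
  shows "(\<lambda>x. g (x - s)) \<in> L2 (s + c) (s + d)"
proof (rule L2_I)
  have eq: "(\<lambda>x. indicator {s + c<..<s + d} x *\<^sub>R k (x - s)) = (\<lambda>x. (\<lambda>y. indicator {c<..<d} y *\<^sub>R k y) (- s + 1 * x))"
    for k :: "real \<Rightarrow> real"
    by (auto simp: indicator_def algebra_simps)
  have m: "(\<lambda>y. indicator {c<..<d} y *\<^sub>R g y) \<in> borel_measurable borel"
    using L2_borel[OF assms] by (simp add: set_borel_measurable_def)
  show "set_borel_measurable lborel {s + c<..<s + d} (\<lambda>x. g (x - s))"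
    unfolding set_borel_measurable_def eq
    by (rule measurable_compose[OF _ m]) simp
  have "integrable lborel (\<lambda>y. indicator {c<..<d} y *\<^sub>R (g y)\<^sup>2)"
    using L2_square[OF assms] by (simp add: set_integrable_def)
  then show "set_integrable lborel {s + c<..<s + d} (\<lambda>x. (g (x - s))\<^sup>2)"
    unfolding set_integrable_def eq[of "\<lambda>y. (g y)\<^sup>2"]
    by (intro lborel_integrable_real_affine) auto
qed

lemma L2_zero_extend:
  assumes "f \<in> L2 c d" "a \<le> c" "d \<le> b"
  shows "(\<lambda>x. if x \<in> {c<..<d} then f x else 0) \<in> L2 a b"
proof (rule L2_I)
  have eq: "(\<lambda>x. indicator {a<..<b} x *\<^sub>R (if x \<in> {c<..<d} then k x else 0)) = (\<lambda>x. indicator {c<..<d} x *\<^sub>R k x)"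
    for k :: "real \<Rightarrow> real"
    using assms(2,3) by (auto simp: indicator_def)
  show "set_borel_measurable lborel {a<..<b} (\<lambda>x. if x \<in> {c<..<d} then f x else 0)"
    using L2_borel[OF assms(1)] unfolding set_borel_measurable_def eq .
  have "(\<lambda>x. indicator {a<..<b} x *\<^sub>R (if x \<in> {c<..<d} then f x else 0)\<^sup>2) = (\<lambda>x. indicator {c<..<d} x *\<^sub>R (f x)\<^sup>2)"
    using assms(2,3) by (auto simp: indicator_def)
  then show "set_integrable lborel {a<..<b} (\<lambda>x. (if x \<in> {c<..<d} then f x else 0)\<^sup>2)"
    using L2_square[OF assms(1)] unfolding set_integrable_def by simp
qed

lemma prim_zero_extend:
  assumes "a \<le> c"
  shows "prim a (\<lambda>x. if x \<in> {c<..<d} then f x else 0) x = (if x \<le> c then 0 else prim c f (min x d))"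
proof -
  have "prim a (\<lambda>x. if x \<in> {c<..<d} then f x else 0) x = (LINT y:{c<..<min x d}|lborel. f y)"
    unfolding prim_def set_lebesgue_integral_def using assms
    by (intro Bochner_Integration.integral_cong) (auto simp: indicator_def)
  then show ?thesis
    by (auto simp: prim_def set_lebesgue_integral_def)
qed

text \<open>
  The primitive of the indicator of the \<open>i\<close>-th cell.  A hat function is a difference of two
  consecutive ramps divided by \<open>h\<close>, so Abel summation converts nodal values into slopes.
\<close>
definition ramp :: "nat \<Rightarrow> nat \<Rightarrow> real \<Rightarrow> real" where
  "ramp n i x = max 0 (min (mesh n) (x - node n (i - 1)))"

lemma hat_eq_ramps:
  assumes "n > 0" "j > 0"
  shows "hat n j x = (ramp n j x - ramp n (j + 1) x) / mesh n"
proof -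
  have h: "mesh n > 0" by (rule mesh_pos[OF assms(1)])
  define y where "y = x - node n j"
  have "ramp n j x = max 0 (min (mesh n) (y + mesh n))" "ramp n (j + 1) x = max 0 (min (mesh n) y)"
    using assms by (auto simp: ramp_def y_def node_pred[of j])
  moreover have "hat n j x = max 0 (mesh n - \<bar>y\<bar>) / mesh n"
    using h by (auto simp: hat_def y_def max_def field_simps)
  moreover have "max 0 (mesh n - \<bar>y\<bar>) = max 0 (min (mesh n) (y + mesh n)) - max 0 (min (mesh n) y)"
    using h by (auto simp: max_def min_def)
  ultimately show ?thesis by simp
qed

lemma sum_by_parts:
  fixes c T :: "nat \<Rightarrow> real"
  assumes "c 0 = 0" "c n = 0"
  shows "(\<Sum>i=1..n. (c i - c (i - 1)) * T i) = (\<Sum>j=1..n - 1. c j * (T j - T (j + 1)))"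
proof (cases n)
  case (Suc m)
  have "(\<Sum>i=1..Suc k. (c i - c (i - 1)) * T i) = (\<Sum>j=1..k. c j * (T j - T (j + 1))) + c (Suc k) * T (Suc k)" for k
    by (induction k) (use assms(1) in \<open>auto simp: algebra_simps\<close>)
  from this[of m] show ?thesis using Suc assms(2) by (simp del: sum.cl_ivl_Suc)
qed simp

locale mesh_bubble =
  fixes n :: nat and B \<beta> :: "real \<Rightarrow> real" and b\<^sub>1 b\<^sub>2 :: real
  assumes n_pos: "n > 0" and \<beta>: "\<beta> \<in> L2 0 (mesh n)"
    and B: "\<And>x. x \<in> {0..mesh n} \<Longrightarrow> B x = prim 0 \<beta> x" and B_end: "B (mesh n) = 0"
    and B_mean: "(LINT x:{0<..<mesh n}|lborel. B x) = b\<^sub>1 * mesh n"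
    and B_energy: "(LINT x:{0<..<mesh n}|lborel. (\<beta> x)\<^sup>2) = b\<^sub>2 / mesh n"
begin

lemma mesh_n_pos: "mesh n > 0" by (rule mesh_pos[OF n_pos])

lemma shifted_L2:
  assumes "i > 0"
  shows "(\<lambda>x. 1 + mesh n * \<beta> (x - node n (i - 1))) \<in> L2 (node n (i - 1)) (node n i)"
proof -
  have "(\<lambda>x. \<beta> (x - node n (i - 1))) \<in> L2 (node n (i - 1)) (node n i)"
    using L2_shift[OF \<beta>, of "node n (i - 1)"] assms by (simp add: node_pred)
  from L2_add[OF continuous_L2[OF continuous_on_const] L2_cmult[OF this]] show ?thesis .
qed

lemma elem_deriv_L2:
  assumes "i \<in> {1..n}" shows "elem_deriv n \<beta> i \<in> L2 0 1"
  unfolding elem_deriv_def[abs_def]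
  using assms n_pos by (intro L2_zero_extend shifted_L2) (auto simp: node_nonneg node_le_1)

lemma mesh_deriv_L2: "mesh_deriv n \<beta> d \<in> L2 0 1"
  unfolding mesh_deriv_def[abs_def] by (intro L2_sum L2_cmult elem_deriv_L2)

lemma B_start: "B 0 = 0" using B[of 0] mesh_n_pos by simp

text \<open>
  Left of the cell nothing has been integrated, inside it the profile \<open>B\<close> is the primitive of \<open>\<beta>\<close>,
  and to the right the bubble has returned to zero.
\<close>
lemma prim_elem_deriv:
  assumes i: "i \<in> {1..n}"
  shows "prim 0 (elem_deriv n \<beta> i) x = ramp n i x + mesh n * bubble n B i x"
proof -
  let ?s = "node n (i - 1)"
  have i0: "i > 0" using i by simp
  have P: "prim ?s (\<lambda>x. 1 + mesh n * \<beta> (x - ?s)) y = (y - ?s) + mesh n * B (y - ?s)"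
    if y: "?s < y" "y \<le> node n i" for y
  proof -
    have L: "(\<lambda>x. \<beta> (x - ?s)) \<in> L2 ?s y"
      using L2_subset[OF L2_shift[OF \<beta>, of ?s], of ?s y] y i0 by (simp add: node_pred)
    have "prim ?s (\<lambda>x. 1 + mesh n * \<beta> (x - ?s)) y = (LINT x:{?s<..<y}|lborel. 1) + mesh n * (LINT x:{?s<..<y}|lborel. \<beta> (x - ?s))"
      unfolding prim_def set_integral_mult_right[symmetric]
      by (intro set_integral_add(2) set_integrable_const set_integrable_mult_right L2_integrable L)
    also have "(LINT x:{?s<..<y}|lborel. \<beta> (x - ?s)) = prim 0 \<beta> (y - ?s)"
      using set_integral_shift[of ?s 0 "y - ?s" \<beta>] by (simp add: prim_def)
    also have "\<dots> = B (y - ?s)"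
      using B[of "y - ?s"] y i0 by (simp add: node_pred)
    finally show ?thesis using set_integral_const_Ioo[of ?s y 1] y by simp
  qed
  have "prim 0 (elem_deriv n \<beta> i) x = (if x \<le> ?s then 0 else prim ?s (\<lambda>x. 1 + mesh n * \<beta> (x - ?s)) (min x (node n i)))"
    unfolding elem_deriv_def[abs_def] by (rule prim_zero_extend[OF node_nonneg])
  also have "\<dots> = ramp n i x + mesh n * bubble n B i x"
  proof -
    consider "x < ?s" | "x = ?s" | "?s < x" "x \<le> node n i" | "node n i < x" by linarith
    then show ?thesis
    proof cases
      case 4
      then show ?thesis using P[of "node n i"] mesh_n_pos i0 B_end by (auto simp: ramp_def bubble_def node_pred)
    qed (use P[of x] mesh_n_pos i0 B_start in \<open>auto simp: ramp_def bubble_def node_pred\<close>)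
  qed
  finally show ?thesis .
qed

lemma prim_mesh_deriv_sum:
  assumes "x \<le> 1"
  shows "prim 0 (mesh_deriv n \<beta> d) x = (\<Sum>i=1..n. d i * (ramp n i x + mesh n * bubble n B i x))"
proof -
  have *: "prim 0 (\<lambda>x. \<Sum>i\<in>I. d i * elem_deriv n \<beta> i x) x = (\<Sum>i\<in>I. d i * prim 0 (elem_deriv n \<beta> i) x)"
    if "finite I" "I \<subseteq> {1..n}" for I
    using that
  proof (induction I)
    case empty
    then show ?case by (simp add: prim_def)
  next
    case (insert i I)
    have "prim 0 (\<lambda>x. d i * elem_deriv n \<beta> i x + 1 * (\<Sum>i\<in>I. d i * elem_deriv n \<beta> i x)) x
        = d i * prim 0 (elem_deriv n \<beta> i) x + 1 * prim 0 (\<lambda>x. \<Sum>i\<in>I. d i * elem_deriv n \<beta> i x) x"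
      using insert.prems by (intro prim_lincomb[of 0 1] L2_integrable L2_sum L2_cmult elem_deriv_L2 assms) auto
    then show ?case using insert by simp
  qed
  show ?thesis
    unfolding mesh_deriv_def[abs_def] by (simp add: * prim_elem_deriv)
qed

lemma mesh_deriv_total: "prim 0 (mesh_deriv n \<beta> d) 1 = mesh n * (\<Sum>i=1..n. d i)"
proof -
  have "ramp n i 1 = mesh n" "bubble n B i 1 = 0" if "i \<in> {1..n}" for i
  proof -
    have "node n i \<le> 1" using that n_pos by (intro node_le_1) auto
    then show "ramp n i 1 = mesh n" using that mesh_n_pos node_pred[of i n] by (auto simp: ramp_def)
    have "1 - node n (i - 1) = mesh n" if "1 \<le> node n i"
      using \<open>node n i \<le> 1\<close> that \<open>i \<in> {1..n}\<close> node_pred[of i n] by simp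
    then show "bubble n B i 1 = 0"
      using B_end by (auto simp: bubble_def)
  qed
  then show ?thesis by (simp add: prim_mesh_deriv_sum sum_distrib_left mult.commute)
qed

lemma mesh_function_eq_prim:
  assumes "c 0 = 0" "c n = 0" "x \<le> 1"
  shows "(\<Sum>j=1..n - 1. c j * (hat n j x + (bubble n B j x - bubble n B (j + 1) x)))
       = prim 0 (mesh_deriv n \<beta> (\<lambda>i. (c i - c (i - 1)) / mesh n)) x"
proof -
  define T where "T i = ramp n i x / mesh n + bubble n B i x" for i
  have "prim 0 (mesh_deriv n \<beta> (\<lambda>i. (c i - c (i - 1)) / mesh n)) x = (\<Sum>i=1..n. (c i - c (i - 1)) * T i)"
    unfolding prim_mesh_deriv_sum[OF assms(3)] T_def
    using mesh_n_pos by (intro sum.cong) (auto simp: field_simps)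
  also have "\<dots> = (\<Sum>j=1..n - 1. c j * (T j - T (j + 1)))"
    by (rule sum_by_parts[OF assms(1,2)])
  also have "\<dots> = (\<Sum>j=1..n - 1. c j * (hat n j x + (bubble n B j x - bubble n B (j + 1) x)))"
    by (rule sum.cong) (use n_pos in \<open>auto simp: T_def hat_eq_ramps diff_divide_distrib\<close>)
  finally show ?thesis by simp
qed

lemma zero_primitive_of_prim:
  assumes "\<And>x. x \<in> {0..1} \<Longrightarrow> v x = prim 0 (mesh_deriv n \<beta> d) x" "(\<Sum>i=1..n. d i) = 0"
  shows "zero_primitive 0 1 v (mesh_deriv n \<beta> d)"
proof -
  have "continuous_on {0..1} v"
    using prim_continuous[OF L2_integrable[OF mesh_deriv_L2]] by (rule continuous_on_eq) (simp add: assms)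
  then have "set_borel_measurable lborel {0<..<1} v"
    by (intro set_integrable_borel continuous_integrable)
  then show ?thesis
    using assms by (auto simp: zero_primitive_def mesh_deriv_L2 mesh_deriv_total)
qed

lemma test_space_zero_primitive:
  assumes "v \<in> test_space n B"
  obtains d where "(\<Sum>i=1..n. d i) = 0" "zero_primitive 0 1 v (mesh_deriv n \<beta> d)"
proof -
  obtain c0 where v: "v = (\<lambda>x. \<Sum>j=1..n - 1. c0 j * (hat n j x + (bubble n B j x - bubble n B (j + 1) x)))"
    using assms by (auto simp: test_space_def)
  define c where "c j = (if j \<in> {1..n - 1} then c0 j else 0)" for j
  define d where "d i = (c i - c (i - 1)) / mesh n" for i
  have c: "c 0 = 0" "c n = 0" using n_pos by (auto simp: c_def)
  have sum: "(\<Sum>i=1..n. d i) = 0"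
    using sum_telescope''[of 0 n c] n_pos c by (simp add: d_def sum_divide_distrib[symmetric] atLeastSucAtMost_greaterThanAtMost[symmetric])
  have "v x = prim 0 (mesh_deriv n \<beta> d) x" if "x \<in> {0..1}" for x
  proof -
    have "v x = (\<Sum>j=1..n - 1. c j * (hat n j x + (bubble n B j x - bubble n B (j + 1) x)))"
      unfolding v by (rule sum.cong) (auto simp: c_def)
    then show ?thesis
      using mesh_function_eq_prim[OF c, of x] that by (simp add: d_def[abs_def])
  qed
  then show ?thesis using that zero_primitive_of_prim[OF _ sum] sum by blast
qed

text \<open>
  Partial sums of the slopes are the nodal values; the last one vanishes by the assumption on \<open>d\<close>.
\<close>
lemma test_space_exists:
  assumes "(\<Sum>i=1..n. d i) = 0"
  obtains v where "v \<in> test_space n B" "zero_primitive 0 1 v (mesh_deriv n \<beta> d)"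
proof -
  define c where "c j = mesh n * (\<Sum>i=1..j. d i)" for j
  define v where "v x = (\<Sum>j=1..n - 1. c j * (hat n j x + (bubble n B j x - bubble n B (j + 1) x)))" for x
  have c: "c 0 = 0" "c n = 0" using assms by (auto simp: c_def)
  have d: "mesh_deriv n \<beta> (\<lambda>i. (c i - c (i - 1)) / mesh n) = mesh_deriv n \<beta> d"
  proof -
    have "(c i - c (i - 1)) / mesh n = d i" if "i \<in> {1..n}" for i
      using that mesh_n_pos by (cases i) (auto simp: c_def right_diff_distrib[symmetric])
    then show ?thesis unfolding mesh_deriv_def[abs_def] by (intro ext sum.cong) auto
  qed
  have "v \<in> test_space n B" by (auto simp: test_space_def v_def[abs_def])
  moreover have "zero_primitive 0 1 v (mesh_deriv n \<beta> d)"
    using mesh_function_eq_prim[OF c] d by (intro zero_primitive_of_prim assms) (auto simp: v_def)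
  ultimately show ?thesis using that by blast
qed

end

section \<open>Bilinear form and norm in terms of derivatives\<close>

text \<open>
  The form \<open>b(v,u)\<close>, expressed through the derivatives \<open>g\<close> of \<open>u\<close> and \<open>k\<close> of \<open>v\<close>; note that here the
  trial function comes first.
\<close>
definition conv_form :: "real \<Rightarrow> (real \<Rightarrow> real) \<Rightarrow> (real \<Rightarrow> real) \<Rightarrow> real" where
  "conv_form \<epsilon> g k = \<epsilon> * (LINT x:{0<..<1}|lborel. g x * k x) + (LINT x:{0<..<1}|lborel. g x * prim 0 k x)"

lemma conv_form_eq:
  assumes "g \<in> L2 0 1" "k \<in> L2 0 1" "prim 0 g 1 = 0"
  shows "conv_form \<epsilon> g k = (LINT x:{0<..<1}|lborel. (\<epsilon> * g x - prim 0 g x) * k x)"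
proof -
  note gi = L2_integrable[OF assms(1)] and ki = L2_integrable[OF assms(2)]
  have i: "set_integrable lborel {0<..<1} (\<lambda>x. \<epsilon> * (g x * k x))" "set_integrable lborel {0<..<1} (\<lambda>x. prim 0 g x * k x)"
    by (intro set_integrable_mult_right L2_mult assms(1,2))
       (intro continuous_bounded_integrable prim_continuous gi ki)
  have "(LINT x:{0<..<1}|lborel. (\<epsilon> * g x - prim 0 g x) * k x) = (LINT x:{0<..<1}|lborel. \<epsilon> * (g x * k x) - prim 0 g x * k x)"
    by (simp add: algebra_simps)
  also have "\<dots> = \<epsilon> * (LINT x:{0<..<1}|lborel. g x * k x) - (LINT x:{0<..<1}|lborel. prim 0 g x * k x)"
    using set_integral_diff(2)[OF i] by simp
  finally show ?thesis
    using prim_integration_by_parts[OF _ gi ki] assms(3) by (simp add: conv_form_def)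
qed

lemma conv_form_lincomb_left:
  assumes "g \<in> L2 0 1" "k \<in> L2 0 1" "l \<in> L2 0 1"
  shows "conv_form \<epsilon> (\<lambda>x. p * g x + q * k x) l = p * conv_form \<epsilon> g l + q * conv_form \<epsilon> k l"
proof -
  have *: "(LINT x:{0<..<1}|lborel. (p * g x + q * k x) * w x) = p * (LINT x:{0<..<1}|lborel. g x * w x) + q * (LINT x:{0<..<1}|lborel. k x * w x)"
    if "w \<in> L2 0 1" for w
  proof -
    have "(LINT x:{0<..<1}|lborel. (p * g x + q * k x) * w x) = (LINT x:{0<..<1}|lborel. p * (g x * w x) + q * (k x * w x))"
      by (simp add: algebra_simps)
    also have "\<dots> = (LINT x:{0<..<1}|lborel. p * (g x * w x)) + (LINT x:{0<..<1}|lborel. q * (k x * w x))"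
      by (intro set_integral_add(2) set_integrable_mult_right L2_mult assms that)
    finally show ?thesis by simp
  qed
  have "prim 0 l \<in> L2 0 1" by (intro continuous_L2 prim_continuous L2_integrable assms)
  then show ?thesis using *[OF assms(3)] *[of "prim 0 l"] by (simp add: conv_form_def algebra_simps)
qed

lemma zero_primitive_bform:
  assumes u: "zero_primitive 0 1 u g" and v: "zero_primitive 0 1 v k"
  shows "bform \<epsilon> v u = conv_form \<epsilon> g k"
proof -
  note wu = zero_primitive_weak_deriv[OF zero_le_one u] and wv = zero_primitive_weak_deriv[OF zero_le_one v]
  have gk: "g \<in> L2 0 1" "k \<in> L2 0 1" using u v by (auto simp: zero_primitive_def)
  have L: "g \<in> L2 0 1" "k \<in> L2 0 1" "prim 0 k \<in> L2 0 1"
    by (intro gk continuous_L2 prim_continuous L2_integrable)+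
  have vm: "set_borel_measurable lborel {0<..<1} v" and va: "AE x\<in>{0<..<1} in lborel. v x = prim 0 k x"
    using v by (auto simp: zero_primitive_def)
  have "(LINT x:{0<..<1}|lborel. weak_deriv 0 1 u x * weak_deriv 0 1 v x) = (LINT x:{0<..<1}|lborel. g x * k x)"
  proof (rule set_integral_cong_AE_borel)
    show "AE x\<in>{0<..<1} in lborel. weak_deriv 0 1 u x * weak_deriv 0 1 v x = g x * k x"
      using wu(1) wv(1) by eventually_elim simp
  qed (intro set_borel_measurable_mult L2_borel wu wv L)+
  moreover have "(LINT x:{0<..<1}|lborel. weak_deriv 0 1 u x * v x) = (LINT x:{0<..<1}|lborel. g x * prim 0 k x)"
  proof (rule set_integral_cong_AE_borel)
    show "AE x\<in>{0<..<1} in lborel. weak_deriv 0 1 u x * v x = g x * prim 0 k x"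
      using wu(1) va by eventually_elim simp
  qed (rule set_borel_measurable_mult L2_borel wu wv L vm)+
  ultimately show ?thesis by (simp add: bform_def conv_form_def)
qed

lemma test_zero_primitive:
  assumes "\<phi> \<in> test_functions a b" "a \<le> b"
  shows "zero_primitive a b \<phi> (deriv \<phi>)"
  using test_prim[OF assms(2,1)] test_zero[OF assms(1), of b] assms
  by (auto simp: zero_primitive_def intro!: continuous_L2 test_deriv_continuous[OF assms(1)] set_integrable_borel test_integrable)

lemma test_H01:
  assumes \<phi>: "\<phi> \<in> test_functions a b" and "a \<le> b"
  shows "\<phi> \<in> H01 a b"
proof -
  have "has_weak_deriv a b \<phi> (deriv \<phi>)"
    using has_weak_deriv_prim[of a b "deriv \<phi>" \<phi> 0] test_zero_primitive[OF assms] assms(2)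
    by (auto simp: zero_primitive_def)
  then have 1: "\<phi> \<in> H1 a b"
    using continuous_L2[OF test_continuous[OF \<phi>]] by (auto simp: H1_def)
  have "zero_primitive a b (\<lambda>x. 0) (\<lambda>x. 0)"
    by (auto simp: zero_primitive_def prim_def set_borel_measurable_def intro: continuous_L2)
  then have "AE x\<in>{a<..<b} in lborel. weak_deriv a b (\<lambda>x. 0) x = 0" and L: "weak_deriv a b (\<lambda>x. 0) \<in> L2 a b"
    using zero_primitive_weak_deriv[OF assms(2)] by auto
  then have "AE x\<in>{a<..<b} in lborel. (weak_deriv a b (\<lambda>x. 0) x)\<^sup>2 = 0" by (auto elim: eventually_mono)
  then have "(LINT x:{a<..<b}|lborel. (weak_deriv a b (\<lambda>x. 0) x)\<^sup>2) = (LINT x:{a<..<b}|lborel. 0)"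
    by (intro set_integral_cong_AE_borel set_integrable_borel[OF L2_square[OF L]] set_integrable_borel[OF set_integrable_const]) auto
  then have "H1_norm a b (\<lambda>x. 0) = 0" by (simp add: H1_norm_def)
  then show ?thesis
    using 1 \<phi> by (auto simp: H01_def intro!: exI[of _ "\<lambda>_. \<phi>"])
qed

text \<open>
  Let \<open>F\<close> be the primitive of \<open>f\<close>.  Testing with smooth functions shows that \<open>\<epsilon> u' - u + F\<close> has weak
  derivative zero, so it is a constant \<open>c\<close> by du Bois-Reymond.  For any \<open>v\<close> with derivative \<open>k\<close> and
  vanishing boundary values, \<open>b(v,u)\<close> becomes \<open>\<integral> (c - F) k\<close>, which is \<open>\<integral> f v\<close>.
\<close>
lemma weak_solution_tests_primitives:
  assumes f: "continuous_on {0..1} f" and u: "zero_primitive 0 1 u g"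
    and weak: "\<forall>v\<in>H01 0 1. bform \<epsilon> v u = L2_prod f v"
    and v: "zero_primitive 0 1 v k"
  shows "bform \<epsilon> v u = L2_prod f v"
proof -
  have g: "g \<in> L2 0 1" and g0: "prim 0 g 1 = 0" and k: "k \<in> L2 0 1" and k0: "prim 0 k 1 = 0"
    and vm: "set_borel_measurable lborel {0<..<1} v" and va: "AE x\<in>{0<..<1} in lborel. v x = prim 0 k x"
    using u v by (auto simp: zero_primitive_def)
  note gi = L2_integrable[OF g] and ki = L2_integrable[OF k] and fi = continuous_integrable[OF f]
  define w where "w x = (\<epsilon> * g x - prim 0 g x) + prim 0 f x" for x
  have w1: "(\<lambda>x. \<epsilon> * g x - prim 0 g x) \<in> L2 0 1"
    by (intro L2_diff L2_cmult g continuous_L2 prim_continuous gi)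
  have Fc: "prim 0 f \<in> L2 0 1" by (intro continuous_L2 prim_continuous fi)
  have w: "w \<in> L2 0 1" unfolding w_def[abs_def] by (rule L2_add[OF w1 Fc])
  have "\<exists>c. AE x\<in>{0<..<1} in lborel. w x = c"
  proof (rule du_Bois_Reymond)
    fix \<phi> assume \<phi>: "\<phi> \<in> test_functions 0 (1::real)"
    have d: "deriv \<phi> \<in> L2 0 1" by (intro continuous_L2 test_deriv_continuous[OF \<phi>])
    have "(LINT x:{0<..<1}|lborel. w x * deriv \<phi> x)
        = (LINT x:{0<..<1}|lborel. (\<epsilon> * g x - prim 0 g x) * deriv \<phi> x + prim 0 f x * deriv \<phi> x)"
      by (simp add: w_def algebra_simps)
    also have "\<dots> = conv_form \<epsilon> g (deriv \<phi>) + (LINT x:{0<..<1}|lborel. prim 0 f x * deriv \<phi> x)"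
      unfolding conv_form_eq[OF g d g0] by (intro set_integral_add(2) L2_mult w1 d Fc)
    also have "\<dots> = bform \<epsilon> \<phi> u - (LINT x:{0<..<1}|lborel. f x * \<phi> x)"
      using zero_primitive_bform[OF u test_zero_primitive[OF \<phi>]] prim_times_test_deriv[OF _ fi \<phi>] by simp
    also have "\<dots> = 0" using weak test_H01[OF \<phi>] by (simp add: L2_prod_def)
    finally show "(LINT x:{0<..<1}|lborel. w x * deriv \<phi> x) = 0" .
  qed (auto intro: L2_integrable w)
  then obtain c where c: "AE x\<in>{0<..<1} in lborel. w x = c" ..
  have "bform \<epsilon> v u = (LINT x:{0<..<1}|lborel. (\<epsilon> * g x - prim 0 g x) * k x)"
    using zero_primitive_bform[OF u v] conv_form_eq[OF g k g0] by simp
  also have "\<dots> = (LINT x:{0<..<1}|lborel. c * k x - prim 0 f x * k x)"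
  proof (rule set_integral_cong_AE_borel)
    show "AE x\<in>{0<..<1} in lborel. (\<epsilon> * g x - prim 0 g x) * k x = c * k x - prim 0 f x * k x"
      using c
    proof eventually_elim
      case (elim x)
      then have "x \<in> {0<..<1} \<longrightarrow> \<epsilon> * g x - prim 0 g x = c - prim 0 f x" by (auto simp: w_def)
      then show ?case by (simp add: left_diff_distrib)
    qed
  qed (rule set_integrable_borel set_integral_diff(1) set_integrable_mult_right L2_mult w1 Fc k ki)+
  also have "\<dots> = c * prim 0 k 1 - (LINT x:{0<..<1}|lborel. prim 0 f x * k x)"
    unfolding prim_def[of 0 k] set_integral_mult_right[symmetric]
    by (intro set_integral_diff(2) set_integrable_mult_right L2_mult Fc k ki)
  also have "\<dots> = (LINT x:{0<..<1}|lborel. f x * prim 0 k x)"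
    using prim_integration_by_parts[OF _ fi ki] k0 by simp
  also have "\<dots> = L2_prod f v"
    unfolding L2_prod_def
  proof (rule set_integral_cong_AE_borel)
    show "AE x\<in>{0<..<1} in lborel. f x * prim 0 k x = f x * v x"
      using va by eventually_elim simp
  qed (rule set_borel_measurable_mult set_integrable_borel[OF fi] L2_borel continuous_L2 prim_continuous ki vm)+
  finally show ?thesis .
qed

definition cell_mean :: "nat \<Rightarrow> nat \<Rightarrow> (real \<Rightarrow> real) \<Rightarrow> real" where
  "cell_mean n i g = 1 / mesh n * (LINT x:{node n (i - 1)<..<node n i}|lborel. prim 0 g x)"

definition total_mean :: "(real \<Rightarrow> real) \<Rightarrow> real" where
  "total_mean g = (LINT x:{0<..<1}|lborel. prim 0 g x)"

text \<open>
  For \<open>\<kappa> = \<epsilon> + h b\<^sub>1\<close> this is \<open>1 + b\<^sub>2\<close> times the inner product that belongs to the discrete optimal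
  norm.
\<close>
definition norm_form :: "real \<Rightarrow> nat \<Rightarrow> (real \<Rightarrow> real) \<Rightarrow> (real \<Rightarrow> real) \<Rightarrow> real" where
  "norm_form \<kappa> n g k = \<kappa>\<^sup>2 * (LINT x:{0<..<1}|lborel. g x * k x)
     + 1 / real n * (\<Sum>i=1..n. cell_mean n i g * cell_mean n i k) - total_mean g * total_mean k"

lemma zero_primitive_norm:
  assumes "n > 0" and u: "zero_primitive 0 1 u g"
  shows "discrete_optimal_norm \<epsilon> b\<^sub>1 b\<^sub>2 n u = sqrt (norm_form (\<epsilon> + mesh n * b\<^sub>1) n g g / (1 + b\<^sub>2))"
proof -
  have g: "g \<in> L2 0 1" and um: "set_borel_measurable lborel {0<..<1} u" and ua: "AE x\<in>{0<..<1} in lborel. u x = prim 0 g x"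
    using u by (auto simp: zero_primitive_def)
  have G: "prim 0 g \<in> L2 0 1" by (intro continuous_L2 prim_continuous L2_integrable g)
  note wu = zero_primitive_weak_deriv[OF zero_le_one u]
  have "(LINT x:{0<..<1}|lborel. (weak_deriv 0 1 u x)\<^sup>2) = (LINT x:{0<..<1}|lborel. (g x)\<^sup>2)"
  proof (rule set_integral_cong_AE_borel)
    show "AE x\<in>{0<..<1} in lborel. (weak_deriv 0 1 u x)\<^sup>2 = (g x)\<^sup>2"
      using wu(1) by eventually_elim simp
  qed (intro set_integrable_borel L2_square wu g)+
  then have e: "(energy_seminorm u)\<^sup>2 = (LINT x:{0<..<1}|lborel. (g x)\<^sup>2)"
    by (simp add: energy_seminorm_def set_integral_nonneg_real)
  have sub: "(LINT x:{c<..<d}|lborel. u x) = (LINT x:{c<..<d}|lborel. prim 0 g x)" if "0 \<le> c" "d \<le> 1" for c d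
  proof (rule set_integral_cong_AE_borel)
    show "AE x\<in>{c<..<d} in lborel. u x = prim 0 g x"
      using ua by eventually_elim (use that in auto)
  qed (use that in \<open>auto intro!: set_borel_measurable_subset[OF um] set_borel_measurable_subset[OF L2_borel[OF G]]\<close>)
  have "(\<Sum>i=1..n. (1 / mesh n * (LINT x:{node n (i - 1)<..<node n i}|lborel. u x))\<^sup>2) = (\<Sum>i=1..n. cell_mean n i g * cell_mean n i g)"
    using assms(1) by (intro sum.cong) (auto simp: cell_mean_def power2_eq_square sub node_nonneg node_le_1)
  then have "discrete_seminorm_sq n u = 1 / real n * (\<Sum>i=1..n. cell_mean n i g * cell_mean n i g) - total_mean g * total_mean g"
    unfolding discrete_seminorm_sq_def by (simp add: sub total_mean_def power2_eq_square)
  then show ?thesis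
    unfolding discrete_optimal_norm_def e norm_form_def by (simp add: power2_eq_square add_divide_distrib diff_divide_distrib)
qed

lemma norm_form_lincomb:
  assumes "n > 0" "g \<in> L2 0 1" "k \<in> L2 0 1"
  shows "norm_form \<kappa> n (\<lambda>x. p * g x + q * k x) (\<lambda>x. p * g x + q * k x)
     = p\<^sup>2 * norm_form \<kappa> n g g + 2 * p * q * norm_form \<kappa> n g k + q\<^sup>2 * norm_form \<kappa> n k k"
proof -
  let ?w = "\<lambda>x. p * g x + q * k x"
  note gi = L2_integrable[OF assms(2)] and ki = L2_integrable[OF assms(3)]
  have "(LINT x:{0<..<1}|lborel. ?w x * ?w x) = (LINT x:{0<..<1}|lborel. p\<^sup>2 * (g x * g x) + (2 * p * q) * (g x * k x) + q\<^sup>2 * (k x * k x))"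
    by (simp add: power2_eq_square algebra_simps)
  also have "\<dots> = (LINT x:{0<..<1}|lborel. p\<^sup>2 * (g x * g x) + (2 * p * q) * (g x * k x)) + (LINT x:{0<..<1}|lborel. q\<^sup>2 * (k x * k x))"
    by (intro set_integral_add set_integrable_mult_right L2_mult assms)
  also have "(LINT x:{0<..<1}|lborel. p\<^sup>2 * (g x * g x) + (2 * p * q) * (g x * k x)) = (LINT x:{0<..<1}|lborel. p\<^sup>2 * (g x * g x)) + (LINT x:{0<..<1}|lborel. (2 * p * q) * (g x * k x))"
    by (intro set_integral_add set_integrable_mult_right L2_mult assms)
  finally have 1: "(LINT x:{0<..<1}|lborel. ?w x * ?w x) = p\<^sup>2 * (LINT x:{0<..<1}|lborel. g x * g x)
      + 2 * p * q * (LINT x:{0<..<1}|lborel. g x * k x) + q\<^sup>2 * (LINT x:{0<..<1}|lborel. k x * k x)" by simp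
  have 2: "(LINT x:{c<..<d}|lborel. prim 0 ?w x) = p * (LINT x:{c<..<d}|lborel. prim 0 g x) + q * (LINT x:{c<..<d}|lborel. prim 0 k x)"
    if "0 \<le> c" "d \<le> 1" for c d
  proof -
    have i: "set_integrable lborel {c<..<d} (\<lambda>x. p * prim 0 g x)" "set_integrable lborel {c<..<d} (\<lambda>x. q * prim 0 k x)"
      by (intro set_integrable_mult_right Ioo_integrable_subset[OF continuous_integrable that] prim_continuous gi ki)+
    have "(LINT x:{c<..<d}|lborel. prim 0 ?w x) = (LINT x:{c<..<d}|lborel. p * prim 0 g x + q * prim 0 k x)"
      using that by (intro set_lebesgue_integral_cong) (auto simp: prim_lincomb[OF gi ki])
    then show ?thesis using set_integral_add(2)[OF i] by simp
  qed
  have m: "cell_mean n i ?w = p * cell_mean n i g + q * cell_mean n i k" if "i \<in> {1..n}" for i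
    using that assms(1) by (simp add: cell_mean_def 2 node_nonneg node_le_1 algebra_simps)
  have t: "total_mean ?w = p * total_mean g + q * total_mean k"
    by (simp add: total_mean_def 2)
  have s: "(\<Sum>i=1..n. cell_mean n i ?w * cell_mean n i ?w) = p\<^sup>2 * (\<Sum>i=1..n. cell_mean n i g * cell_mean n i g)
     + 2 * p * q * (\<Sum>i=1..n. cell_mean n i g * cell_mean n i k) + q\<^sup>2 * (\<Sum>i=1..n. cell_mean n i k * cell_mean n i k)"
    unfolding sum_distrib_left sum.distrib[symmetric]
    by (rule sum.cong) (auto simp: m power2_eq_square algebra_simps)
  show ?thesis
    unfolding norm_form_def 1 s t by (simp add: power2_eq_square algebra_simps add_divide_distrib)
qed

lemma total_mean_eq_cells:
  assumes "n > 0" "g \<in> L2 0 1"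
  shows "total_mean g = mesh n * (\<Sum>i=1..n. cell_mean n i g)"
  using mesh_integral_sum[OF assms(1) continuous_integrable[OF prim_continuous[OF L2_integrable[OF assms(2)]]]] mesh_pos[OF assms(1)]
  by (simp add: total_mean_def cell_mean_def sum_distrib_left)

text \<open>
  The square of the mean of the cell means is at most the mean of their squares.
\<close>
lemma norm_form_nonneg:
  assumes "n > 0" "g \<in> L2 0 1"
  shows "0 \<le> norm_form \<kappa> n g g"
proof -
  have "(\<Sum>i=1..n. cell_mean n i g)\<^sup>2 \<le> (\<Sum>i=1..n. (cell_mean n i g)\<^sup>2) * real n"
    using sum_squared_le_sum_of_squares[of "\<lambda>i. cell_mean n i g" "{1..n}"] by simp
  then have "(mesh n)\<^sup>2 * (\<Sum>i=1..n. cell_mean n i g)\<^sup>2 \<le> (mesh n)\<^sup>2 * ((\<Sum>i=1..n. (cell_mean n i g)\<^sup>2) * real n)"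
    by (intro mult_left_mono) auto
  also have "\<dots> = 1 / real n * (\<Sum>i=1..n. (cell_mean n i g)\<^sup>2)"
    using assms(1) by (simp add: mesh_def power2_eq_square)
  finally have "(total_mean g)\<^sup>2 \<le> 1 / real n * (\<Sum>i=1..n. (cell_mean n i g)\<^sup>2)"
    by (simp add: total_mean_eq_cells[OF assms] power_mult_distrib)
  moreover have "0 \<le> \<kappa>\<^sup>2 * (LINT x:{0<..<1}|lborel. g x * g x)"
    by (rule mult_nonneg_nonneg) (auto intro: set_integral_nonneg_real)
  ultimately show ?thesis by (simp add: norm_form_def power2_eq_square)
qed

section \<open>Stability, boundedness and quasi-optimality\<close>

text \<open>
  Think of \<open>A\<close>, \<open>C\<close>, \<open>B\<close> as the Gram matrix of \<open>x\<close> in the range and \<open>y\<close> in the kernel of a projection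
  whose squared norm is at most \<open>K\<close>.  Rescaling \<open>x\<close> and \<open>y\<close> so that their lengths are exchanged leaves
  the length of \<open>x + y\<close> unchanged, so the bound for \<open>x\<close> turns into the bound for \<open>y\<close>: the
  complementary projection has the same norm.
\<close>
lemma complementary_projection_bound:
  fixes A B C K :: real
  assumes "0 \<le> A" "0 \<le> B" "1 \<le> K"
    and bound: "\<And>p q. p\<^sup>2 * A \<le> K * (p\<^sup>2 * A + 2 * p * q * C + q\<^sup>2 * B)"
  shows "B \<le> K * (A + 2 * C + B)"
proof -
  consider "A = 0" | "B = 0" | "A > 0" "B > 0" using assms(1,2) by linarith
  then show ?thesis
  proof cases
    case 1
    have "C\<^sup>2 \<le> 0 * B"
    proof (rule square_le_of_quadratic_nonneg)
      fix t
      have "0 \<le> K * (2 * C * t + B)" using bound[of t 1] 1 by (simp add: algebra_simps)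
      then show "0 \<le> 0 * t\<^sup>2 + 2 * C * t + B" using assms(3) by (simp add: zero_le_mult_iff)
    qed simp
    then have "C = 0" by simp
    then show ?thesis using 1 assms(2,3) by (simp add: mult_le_cancel_right1)
  next
    case 2
    then show ?thesis using bound[of 1 1] assms(1) by simp
  next
    case 3
    define p where "p = sqrt (B / A)"
    have "p > 0" "p\<^sup>2 = B / A" using 3 by (auto simp: p_def)
    then have "p\<^sup>2 * A = B" "2 * p * (1 / p) = 2" "(1 / p)\<^sup>2 * B = A"
      using 3 by (auto simp: power_divide)
    then show ?thesis using bound[of p "1 / p"] by (simp add: algebra_simps)
  qed
qed

text \<open>
  The algebra behind the choice of slopes: \<open>s\<close> and \<open>m\<close> are the slopes and cell means of a trial
  function, \<open>M\<close> is its mean and \<open>r\<close> the mesh size.  Since \<open>s\<close> has sum zero and is orthogonal to \<open>m\<close>,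
  the mixed terms disappear.
\<close>
lemma sum_cell_means_residual:
  fixes s m :: "nat \<Rightarrow> real" and \<kappa> M r :: real
  assumes "(\<Sum>i=1..n. s i) = 0" "(\<Sum>i=1..n. s i * m i) = 0" "M = r * (\<Sum>i=1..n. m i)" "r * real n = 1"
  shows "r * (\<Sum>i=1..n. (\<kappa> * s i - m i + M)\<^sup>2) = \<kappa>\<^sup>2 * (r * (\<Sum>i=1..n. (s i)\<^sup>2)) + r * (\<Sum>i=1..n. m i * m i) - M * M"
    and "r * (\<Sum>i=1..n. (\<kappa> * s i - m i + M) * (\<kappa> * s i - m i)) = r * (\<Sum>i=1..n. (\<kappa> * s i - m i + M)\<^sup>2)"
    and "(\<Sum>i=1..n. \<kappa> * s i - m i + M) = 0"
proof -
  show 0: "(\<Sum>i=1..n. \<kappa> * s i - m i + M) = 0"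
  proof -
    have "r * (\<Sum>i=1..n. \<kappa> * s i - m i + M) = r * (\<kappa> * (\<Sum>i=1..n. s i) - (\<Sum>i=1..n. m i) + real n * M)"
      by (simp add: sum.distrib sum_subtractf sum_distrib_left)
    also have "\<dots> = - M + (r * real n) * M" using assms(1,3) by (simp add: algebra_simps)
    finally show ?thesis using assms(4) by auto
  qed
  have "(\<Sum>i=1..n. (\<kappa> * s i - m i + M)\<^sup>2) = (\<Sum>i=1..n. (\<kappa> * s i - m i + M) * (\<kappa> * s i - m i) + M * (\<kappa> * s i - m i + M))"
    by (rule sum.cong) (auto simp: power2_eq_square algebra_simps)
  also have "\<dots> = (\<Sum>i=1..n. (\<kappa> * s i - m i + M) * (\<kappa> * s i - m i)) + M * (\<Sum>i=1..n. \<kappa> * s i - m i + M)"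
    by (subst sum.distrib) (simp only: sum_distrib_left)
  finally have 1: "(\<Sum>i=1..n. (\<kappa> * s i - m i + M)\<^sup>2) = (\<Sum>i=1..n. (\<kappa> * s i - m i + M) * (\<kappa> * s i - m i))"
    using 0 by simp
  then show "r * (\<Sum>i=1..n. (\<kappa> * s i - m i + M) * (\<kappa> * s i - m i)) = r * (\<Sum>i=1..n. (\<kappa> * s i - m i + M)\<^sup>2)" by simp
  have "(\<Sum>i=1..n. (\<kappa> * s i - m i + M) * (\<kappa> * s i - m i))
      = (\<Sum>i=1..n. \<kappa>\<^sup>2 * (s i)\<^sup>2 - 2 * \<kappa> * (s i * m i) + m i * m i + M * \<kappa> * s i - M * m i)"
    by (rule sum.cong) (auto simp: power2_eq_square algebra_simps)
  also have "\<dots> = \<kappa>\<^sup>2 * (\<Sum>i=1..n. (s i)\<^sup>2) - 2 * \<kappa> * (\<Sum>i=1..n. s i * m i) + (\<Sum>i=1..n. m i * m i)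
      + M * \<kappa> * (\<Sum>i=1..n. s i) - M * (\<Sum>i=1..n. m i)"
    by (simp only: sum.distrib sum_subtractf sum_distrib_left)
  finally have "(\<Sum>i=1..n. (\<kappa> * s i - m i + M)\<^sup>2) = \<kappa>\<^sup>2 * (\<Sum>i=1..n. (s i)\<^sup>2) + (\<Sum>i=1..n. m i * m i) - M * (\<Sum>i=1..n. m i)"
    using 1 assms(1,2) by simp
  moreover have "M * M = r * (M * (\<Sum>i=1..n. m i))" using assms(3) by (metis mult.left_commute)
  ultimately show "r * (\<Sum>i=1..n. (\<kappa> * s i - m i + M)\<^sup>2) = \<kappa>\<^sup>2 * (r * (\<Sum>i=1..n. (s i)\<^sup>2)) + r * (\<Sum>i=1..n. m i * m i) - M * M"
    by (simp only: distrib_left right_diff_distrib mult.left_commute)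
qed

text \<open>
  With the zero bubble the test space becomes the trial space, so that all facts about mesh functions
  cover both.
\<close>
lemma trial_mesh_bubble: "n > 0 \<Longrightarrow> mesh_bubble n (\<lambda>_. 0) (\<lambda>_. 0) 0 0"
  by unfold_locales (auto simp: prim_def continuous_L2)

lemma trial_space_eq: "trial_space n = test_space n (\<lambda>_. 0)"
  by (simp add: trial_space_def test_space_def bubble_def)

definition trial_deriv :: "nat \<Rightarrow> (nat \<Rightarrow> real) \<Rightarrow> real \<Rightarrow> real" where
  "trial_deriv n s = mesh_deriv n (\<lambda>_. 0) s"

context mesh_bubble
begin

interpretation Z: mesh_bubble n "\<lambda>_. 0" "\<lambda>_. 0" 0 0
  by (rule trial_mesh_bubble[OF n_pos])

lemma trial_deriv_L2: "trial_deriv n s \<in> L2 0 1"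
  unfolding trial_deriv_def by (rule Z.mesh_deriv_L2)

lemma trial_deriv_on_element:
  "i \<in> {1..n} \<Longrightarrow> x \<in> {node n (i - 1)<..<node n i} \<Longrightarrow> trial_deriv n s x = s i"
  unfolding trial_deriv_def using mesh_deriv_on_element[of i n x "\<lambda>_. 0" s] by simp

lemma trial_deriv_total: "prim 0 (trial_deriv n s) 1 = mesh n * (\<Sum>i=1..n. s i)"
  unfolding trial_deriv_def by (rule Z.mesh_deriv_total)

lemma trial_deriv_lincomb:
  "(\<lambda>x. p * trial_deriv n s x + q * trial_deriv n t x) = trial_deriv n (\<lambda>i. p * s i + q * t i)"
  unfolding trial_deriv_def mesh_deriv_def
  by (rule ext) (simp add: sum_distrib_left sum.distrib[symmetric] algebra_simps)

lemma integral_trial_deriv_times: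
  assumes "w \<in> L2 0 1"
  shows "(LINT x:{0<..<1}|lborel. trial_deriv n s x * w x)
       = (\<Sum>i=1..n. s i * (LINT x:{node n (i - 1)<..<node n i}|lborel. w x))"
proof -
  have "(LINT x:{0<..<1}|lborel. trial_deriv n s x * w x)
      = (\<Sum>i=1..n. LINT x:{node n (i - 1)<..<node n i}|lborel. trial_deriv n s x * w x)"
    by (intro mesh_integral_sum n_pos L2_mult trial_deriv_L2 assms)
  also have "\<dots> = (\<Sum>i=1..n. LINT x:{node n (i - 1)<..<node n i}|lborel. s i * w x)"
    by (intro sum.cong set_lebesgue_integral_cong) (auto simp del: One_nat_def simp: trial_deriv_on_element)
  finally show ?thesis by simp
qed

lemma cell_profile:
  assumes "i > 0"
  shows "(LINT x:{node n (i - 1)<..<node n i}|lborel. 1 + mesh n * \<beta> (x - node n (i - 1))) = mesh n"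
    and "(LINT x:{node n (i - 1)<..<node n i}|lborel. (1 + mesh n * \<beta> (x - node n (i - 1)))\<^sup>2) = mesh n * (1 + b\<^sub>2)"
    and "(LINT x:{node n (i - 1)<..<node n i}|lborel. B (x - node n (i - 1))) = mesh n * b\<^sub>1"
proof -
  have sh: "(LINT x:{node n (i - 1)<..<node n i}|lborel. g (x - node n (i - 1))) = (LINT x:{0<..<mesh n}|lborel. g x)"
    for g :: "real \<Rightarrow> real"
    using set_integral_shift[of "node n (i - 1)" 0 "mesh n" g] assms by (simp add: node_pred)
  note \<beta>i = L2_integrable[OF \<beta>]
  have \<beta>0: "(LINT x:{0<..<mesh n}|lborel. \<beta> x) = 0"
    using B[of "mesh n"] B_end mesh_n_pos by (simp add: prim_def)
  have c: "(LINT x:{0<..<mesh n}|lborel. c) = c * mesh n" for c :: real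
    using set_integral_const_Ioo[of 0 "mesh n" c] mesh_n_pos by simp
  have "(LINT x:{0<..<mesh n}|lborel. 1 + mesh n * \<beta> x) = (LINT x:{0<..<mesh n}|lborel. 1) + (LINT x:{0<..<mesh n}|lborel. mesh n * \<beta> x)"
    by (intro set_integral_add(2) set_integrable_const set_integrable_mult_right \<beta>i)
  then show "(LINT x:{node n (i - 1)<..<node n i}|lborel. 1 + mesh n * \<beta> (x - node n (i - 1))) = mesh n"
    using sh[of "\<lambda>y. 1 + mesh n * \<beta> y"] \<beta>0 c by simp
  have "(LINT x:{0<..<mesh n}|lborel. (1 + mesh n * \<beta> x)\<^sup>2) = (LINT x:{0<..<mesh n}|lborel. (1 + (2 * mesh n) * \<beta> x) + (mesh n)\<^sup>2 * (\<beta> x)\<^sup>2)"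
    by (simp add: power2_eq_square algebra_simps)
  also have "\<dots> = (LINT x:{0<..<mesh n}|lborel. 1 + (2 * mesh n) * \<beta> x) + (LINT x:{0<..<mesh n}|lborel. (mesh n)\<^sup>2 * (\<beta> x)\<^sup>2)"
    by (intro set_integral_add set_integrable_const set_integrable_mult_right \<beta>i L2_square \<beta>)
  also have "(LINT x:{0<..<mesh n}|lborel. 1 + (2 * mesh n) * \<beta> x) = (LINT x:{0<..<mesh n}|lborel. 1) + (LINT x:{0<..<mesh n}|lborel. (2 * mesh n) * \<beta> x)"
    by (intro set_integral_add set_integrable_const set_integrable_mult_right \<beta>i)
  finally have "(LINT x:{0<..<mesh n}|lborel. (1 + mesh n * \<beta> x)\<^sup>2) = mesh n + (mesh n)\<^sup>2 * (b\<^sub>2 / mesh n)"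
    using \<beta>0 B_energy c by simp
  then show "(LINT x:{node n (i - 1)<..<node n i}|lborel. (1 + mesh n * \<beta> (x - node n (i - 1)))\<^sup>2) = mesh n * (1 + b\<^sub>2)"
    using sh[of "\<lambda>y. (1 + mesh n * \<beta> y)\<^sup>2"] mesh_n_pos by (simp add: power2_eq_square algebra_simps)
  show "(LINT x:{node n (i - 1)<..<node n i}|lborel. B (x - node n (i - 1))) = mesh n * b\<^sub>1"
    using sh[of B] B_mean by simp
qed

lemma mesh_deriv_energy:
  "(LINT x:{0<..<1}|lborel. (mesh_deriv n \<beta> d x)\<^sup>2) = (1 + b\<^sub>2) * (mesh n * (\<Sum>i=1..n. (d i)\<^sup>2))"
proof -
  have "(LINT x:{0<..<1}|lborel. (mesh_deriv n \<beta> d x)\<^sup>2)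
      = (\<Sum>i=1..n. LINT x:{node n (i - 1)<..<node n i}|lborel. (mesh_deriv n \<beta> d x)\<^sup>2)"
    by (intro mesh_integral_sum n_pos L2_square mesh_deriv_L2)
  also have "\<dots> = (\<Sum>i=1..n. LINT x:{node n (i - 1)<..<node n i}|lborel. (d i)\<^sup>2 * (1 + mesh n * \<beta> (x - node n (i - 1)))\<^sup>2)"
    by (intro sum.cong set_lebesgue_integral_cong) (auto simp del: One_nat_def simp: mesh_deriv_on_element power_mult_distrib)
  also have "\<dots> = (\<Sum>i=1..n. (d i)\<^sup>2 * (mesh n * (1 + b\<^sub>2)))"
    by (intro sum.cong) (auto simp del: One_nat_def simp: cell_profile(2))
  finally show ?thesis by (simp add: sum_distrib_left sum_distrib_right mult_ac)
qed

lemma cell_integral_eq_mean: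
  "i \<in> {1..n} \<Longrightarrow> (LINT x:{node n (i - 1)<..<node n i}|lborel. prim 0 g x) = mesh n * cell_mean n i g"
  using mesh_n_pos by (simp add: cell_mean_def)

text \<open>
  Integration by parts for two trial functions, written with slopes and cell means.  For \<open>d = s\<close> it
  says that the slopes of a trial function are orthogonal to its cell means.
\<close>
lemma trial_parts:
  assumes "(\<Sum>i=1..n. s i) = 0"
  shows "(\<Sum>i=1..n. s i * cell_mean n i (trial_deriv n d)) = - (\<Sum>i=1..n. d i * cell_mean n i (trial_deriv n s))"
proof -
  have P: "prim 0 (trial_deriv n d) \<in> L2 0 1" for d
    by (intro continuous_L2 prim_continuous L2_integrable trial_deriv_L2)
  have *: "(LINT x:{0<..<1}|lborel. trial_deriv n s x * prim 0 (trial_deriv n d) x) = mesh n * (\<Sum>i=1..n. s i * cell_mean n i (trial_deriv n d))"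
    for s d
    unfolding integral_trial_deriv_times[OF P] sum_distrib_left
    by (rule sum.cong) (auto simp del: One_nat_def simp: cell_integral_eq_mean)
  have "(LINT x:{0<..<1}|lborel. prim 0 (trial_deriv n s) x * trial_deriv n d x) + (LINT x:{0<..<1}|lborel. trial_deriv n s x * prim 0 (trial_deriv n d) x) = 0"
    using prim_integration_by_parts[OF zero_le_one L2_integrable[OF trial_deriv_L2] L2_integrable[OF trial_deriv_L2], of s d] assms
    by (simp add: trial_deriv_total)
  then have "mesh n * (\<Sum>i=1..n. d i * cell_mean n i (trial_deriv n s)) + mesh n * (\<Sum>i=1..n. s i * cell_mean n i (trial_deriv n d)) = 0"
    using *[of s d] *[of d s] by (simp add: mult.commute)
  then show ?thesis using mesh_n_pos by (simp add: distrib_left[symmetric] add_eq_0_iff)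
qed

text \<open>
  Since \<open>B'\<close> has mean zero, the bubbles do not change the diffusion term.  In the convection term they
  contribute \<open>h\<^sup>2 b\<^sub>1 s\<^sub>i d\<^sub>i\<close> on each cell, which amounts to an artificial diffusion \<open>h b\<^sub>1\<close>.
\<close>
lemma conv_form_trial_test:
  assumes "(\<Sum>i=1..n. s i) = 0"
  shows "conv_form \<epsilon> (trial_deriv n s) (mesh_deriv n \<beta> d)
       = mesh n * (\<Sum>i=1..n. d i * ((\<epsilon> + mesh n * b\<^sub>1) * s i - cell_mean n i (trial_deriv n s)))"
proof -
  have final: "mesh n * (\<Sum>i=1..n. d i * ((\<epsilon> + mesh n * b\<^sub>1) * s i - cell_mean n i (trial_deriv n s)))
      = (\<Sum>i=1..n. \<epsilon> * (s i * (d i * mesh n)) + mesh n * (s i * (d i * (mesh n * b\<^sub>1))) - mesh n * (d i * cell_mean n i (trial_deriv n s)))"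
    unfolding sum_distrib_left by (rule sum.cong) (auto simp: algebra_simps)
  have V: "prim 0 (mesh_deriv n \<beta> d) \<in> L2 0 1"
    by (intro continuous_L2 prim_continuous L2_integrable mesh_deriv_L2)
  have 1: "(LINT x:{0<..<1}|lborel. trial_deriv n s x * mesh_deriv n \<beta> d x) = (\<Sum>i=1..n. s i * (d i * mesh n))"
    unfolding integral_trial_deriv_times[OF mesh_deriv_L2]
  proof (rule sum.cong)
    fix i assume i: "i \<in> {1..n}"
    have "(LINT x:{node n (i - 1)<..<node n i}|lborel. mesh_deriv n \<beta> d x)
        = (LINT x:{node n (i - 1)<..<node n i}|lborel. d i * (1 + mesh n * \<beta> (x - node n (i - 1))))"
      by (intro set_lebesgue_integral_cong) (auto simp: mesh_deriv_on_element[OF i])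
    then show "s i * (LINT x:{node n (i - 1)<..<node n i}|lborel. mesh_deriv n \<beta> d x) = s i * (d i * mesh n)"
      using cell_profile(1)[of i] i by simp
  qed simp
  have cell: "(LINT x:{node n (i - 1)<..<node n i}|lborel. prim 0 (mesh_deriv n \<beta> d) x)
      = mesh n * cell_mean n i (trial_deriv n d) + mesh n * (d i * (mesh n * b\<^sub>1))" if i: "i \<in> {1..n}" for i
  proof -
    let ?E = "{node n (i - 1)<..<node n i}"
    have le1: "node n i \<le> 1" using i n_pos by (auto intro: node_le_1)
    have "prim 0 (mesh_deriv n \<beta> d) x = prim 0 (trial_deriv n d) x + mesh n * d i * B (x - node n (i - 1))"
      if x: "x \<in> ?E" for x
    proof -
      have bub: "bubble n B k x = (if k = i then B (x - node n (i - 1)) else 0)" if "k \<in> {1..n}" for k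
      proof (cases k i rule: linorder_cases)
        case less
        then have "node n k \<le> node n (i - 1)" by (intro node_mono) auto
        then show ?thesis using x less by (auto simp: bubble_def)
      next
        case greater
        then have "node n i \<le> node n (k - 1)" by (intro node_mono) auto
        then show ?thesis using x greater by (auto simp: bubble_def)
      qed (use x in \<open>auto simp: bubble_def\<close>)
      have x1: "x \<le> 1" using x le1 by simp
      have "prim 0 (mesh_deriv n \<beta> d) x = (\<Sum>k=1..n. d k * (ramp n k x + mesh n * bubble n B k x))"
        by (rule prim_mesh_deriv_sum[OF x1])
      also have "\<dots> = (\<Sum>k=1..n. d k * ramp n k x + (if k = i then mesh n * d i * B (x - node n (i - 1)) else 0))"
      proof (rule sum.cong)
        fix k assume k: "k \<in> {1..n}"
        show "d k * (ramp n k x + mesh n * bubble n B k x)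
            = d k * ramp n k x + (if k = i then mesh n * d i * B (x - node n (i - 1)) else 0)"
          unfolding bub[OF k] by (simp add: distrib_left)
      qed simp
      also have "\<dots> = (\<Sum>k=1..n. d k * ramp n k x) + mesh n * d i * B (x - node n (i - 1))"
        using i by (simp add: sum.distrib)
      also have "(\<Sum>k=1..n. d k * ramp n k x) = prim 0 (trial_deriv n d) x"
        unfolding trial_deriv_def Z.prim_mesh_deriv_sum[OF x1] by (simp add: bubble_def)
      finally show ?thesis .
    qed
    then have "(LINT x:?E|lborel. prim 0 (mesh_deriv n \<beta> d) x)
        = (LINT x:?E|lborel. prim 0 (trial_deriv n d) x + mesh n * d i * B (x - node n (i - 1)))"
      by (intro set_lebesgue_integral_cong) auto
    also have "\<dots> = (LINT x:?E|lborel. prim 0 (trial_deriv n d) x) + (LINT x:?E|lborel. mesh n * d i * B (x - node n (i - 1)))"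
    proof (rule set_integral_add(2))
      show "set_integrable lborel ?E (prim 0 (trial_deriv n d))"
        by (rule Ioo_integrable_subset[OF continuous_integrable[OF prim_continuous[OF L2_integrable[OF trial_deriv_L2]]] node_nonneg le1])
      have "continuous_on {0..mesh n} B"
        using prim_continuous[OF L2_integrable[OF \<beta>]] by (rule continuous_on_eq) (simp add: B)
      from L2_shift[OF continuous_L2[OF this], of "node n (i - 1)"]
      show "set_integrable lborel ?E (\<lambda>x. mesh n * d i * B (x - node n (i - 1)))"
        using i by (intro set_integrable_mult_right L2_integrable) (simp add: node_pred)
    qed
    finally show ?thesis
      unfolding cell_integral_eq_mean[OF i, of "trial_deriv n d"] using cell_profile(3)[of i] i by simp
  qed
  have "(LINT x:{0<..<1}|lborel. trial_deriv n s x * prim 0 (mesh_deriv n \<beta> d) x)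
      = (\<Sum>i=1..n. s i * (mesh n * cell_mean n i (trial_deriv n d) + mesh n * (d i * (mesh n * b\<^sub>1))))"
    unfolding integral_trial_deriv_times[OF V] by (rule sum.cong) (auto simp del: One_nat_def simp: cell)
  also have "\<dots> = mesh n * (\<Sum>i=1..n. s i * cell_mean n i (trial_deriv n d)) + (\<Sum>i=1..n. mesh n * (s i * (d i * (mesh n * b\<^sub>1))))"
    unfolding distrib_left sum.distrib by (simp add: sum_distrib_left mult_ac)
  also have "(\<Sum>i=1..n. s i * cell_mean n i (trial_deriv n d)) = - (\<Sum>i=1..n. d i * cell_mean n i (trial_deriv n s))"
    by (rule trial_parts[OF assms])
  finally show ?thesis
    unfolding conv_form_def 1 final by (simp add: sum.distrib sum_subtractf sum_distrib_left)
qed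

lemma norm_form_trial:
  fixes s :: "nat \<Rightarrow> real" and \<kappa> :: real
  assumes "(\<Sum>i=1..n. s i) = 0"
  defines "d \<equiv> \<lambda>i. \<kappa> * s i - cell_mean n i (trial_deriv n s) + total_mean (trial_deriv n s)"
  shows "norm_form \<kappa> n (trial_deriv n s) (trial_deriv n s) = mesh n * (\<Sum>i=1..n. (d i)\<^sup>2)"
    and "mesh n * (\<Sum>i=1..n. d i * (\<kappa> * s i - cell_mean n i (trial_deriv n s))) = mesh n * (\<Sum>i=1..n. (d i)\<^sup>2)"
proof -
  let ?g = "trial_deriv n s"
  have "(\<Sum>i=1..n. s i * cell_mean n i ?g) = 0"
    using trial_parts[OF assms(1), of s] by simp
  note res = sum_cell_means_residual[OF assms(1) this total_mean_eq_cells[OF n_pos trial_deriv_L2], of \<kappa>]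
  have hn: "mesh n * real n = 1" using n_pos by (simp add: mesh_def)
  have "(LINT x:{0<..<1}|lborel. ?g x * ?g x) = (\<Sum>i=1..n. s i * (s i * mesh n))"
    unfolding integral_trial_deriv_times[OF trial_deriv_L2]
  proof (rule sum.cong)
    fix i assume i: "i \<in> {1..n}"
    have "(LINT x:{node n (i - 1)<..<node n i}|lborel. ?g x) = (LINT x:{node n (i - 1)<..<node n i}|lborel. s i)"
      by (intro set_lebesgue_integral_cong) (auto simp: trial_deriv_on_element[OF i])
    also have "\<dots> = s i * mesh n"
      using set_integral_const_Ioo[of "node n (i - 1)" "node n i" "s i"] i mesh_n_pos by (simp add: node_pred)
    finally show "s i * (LINT x:{node n (i - 1)<..<node n i}|lborel. ?g x) = s i * (s i * mesh n)" by simp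
  qed simp
  then have "(LINT x:{0<..<1}|lborel. ?g x * ?g x) = mesh n * (\<Sum>i=1..n. (s i)\<^sup>2)"
    by (simp add: sum_distrib_left power2_eq_square mult_ac)
  then show "norm_form \<kappa> n ?g ?g = mesh n * (\<Sum>i=1..n. (d i)\<^sup>2)"
    unfolding d_def res(1)[OF hn] norm_form_def by (simp add: mesh_def)
  show "mesh n * (\<Sum>i=1..n. d i * (\<kappa> * s i - cell_mean n i ?g)) = mesh n * (\<Sum>i=1..n. (d i)\<^sup>2)"
    unfolding d_def by (rule res(2)[OF hn])
qed

text \<open>
  With \<open>w = prim 0 g\<close>, the terms that mix \<open>w'\<close> with \<open>w\<close> or with its mean vanish, because \<open>w w'\<close> and
  \<open>w'\<close> have integral zero.  The variance of \<open>w\<close> splits into the variance of its cell means and the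
  variances within the cells, which the Poincare-Wirtinger inequality controls.
\<close>
lemma residual_energy_le_norm_form:
  assumes g: "g \<in> L2 0 1" "prim 0 g 1 = 0" and \<kappa>: "\<epsilon>\<^sup>2 + (mesh n)\<^sup>2 / pi\<^sup>2 \<le> \<kappa>\<^sup>2"
  shows "(LINT x:{0<..<1}|lborel. (\<epsilon> * g x - prim 0 g x + total_mean g)\<^sup>2) \<le> norm_form \<kappa> n g g"
proof -
  let ?G = "prim 0 g" and ?m = "total_mean g"
  define I where "I = (LINT x:{0<..<1}|lborel. (g x)\<^sup>2)"
  note gi = L2_integrable[OF g(1)]
  have G: "?G \<in> L2 0 1" by (intro continuous_L2 prim_continuous gi)
  have gG: "(LINT x:{0<..<1}|lborel. g x * ?G x) = 0"
    using prim_integration_by_parts[OF zero_le_one gi gi] g(2) by (simp add: mult.commute)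
  have i: "set_integrable lborel {0<..<1} (\<lambda>x. \<epsilon>\<^sup>2 * (g x)\<^sup>2)" "set_integrable lborel {0<..<1} (\<lambda>x. (?G x)\<^sup>2)"
    "set_integrable lborel {0<..<1} (\<lambda>x. (2 * \<epsilon>) * (g x * ?G x))" "set_integrable lborel {0<..<1} (\<lambda>x. (2 * \<epsilon> * ?m) * g x)"
    "set_integrable lborel {0<..<1} (\<lambda>x. (2 * ?m) * ?G x)" "set_integrable lborel {0<..<1::real} (\<lambda>x. ?m\<^sup>2)"
    by (intro set_integrable_mult_right L2_square L2_mult L2_integrable set_integrable_const g(1) G)+
  have "(LINT x:{0<..<1}|lborel. (\<epsilon> * g x - ?G x + ?m)\<^sup>2)
      = (LINT x:{0<..<1}|lborel. ((((\<epsilon>\<^sup>2 * (g x)\<^sup>2 + (?G x)\<^sup>2) - (2 * \<epsilon>) * (g x * ?G x)) + (2 * \<epsilon> * ?m) * g x) - (2 * ?m) * ?G x) + ?m\<^sup>2)"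
    by (simp add: power2_eq_square algebra_simps)
  also have "\<dots> = \<epsilon>\<^sup>2 * I + (LINT x:{0<..<1}|lborel. (?G x)\<^sup>2) - ?m\<^sup>2"
  proof -
    note i1 = set_integral_add(1)[OF i(1,2)]
    note i2 = set_integral_diff(1)[OF i1 i(3)]
    note i3 = set_integral_add(1)[OF i2 i(4)]
    note i4 = set_integral_diff(1)[OF i3 i(5)]
    have "(LINT x:{0<..<1}|lborel. g x) = 0" using g(2) by (simp add: prim_def)
    moreover have "(LINT x:{0<..<1::real}|lborel. ?m\<^sup>2) = ?m\<^sup>2"
      using set_integral_const_Ioo[of 0 1 "?m\<^sup>2"] by simp
    ultimately show ?thesis
      unfolding set_integral_add(2)[OF i4 i(6)] set_integral_diff(2)[OF i3 i(5)] set_integral_add(2)[OF i2 i(4)]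
        set_integral_diff(2)[OF i1 i(3)] set_integral_add(2)[OF i(1,2)] set_integral_mult_right gG
      by (simp add: I_def total_mean_def power2_eq_square)
  qed
  also have "\<dots> \<le> norm_form \<kappa> n g g"
  proof -
    have "(LINT x:{0<..<1}|lborel. (?G x)\<^sup>2) = (\<Sum>i=1..n. LINT x:{node n (i - 1)<..<node n i}|lborel. (?G x)\<^sup>2)"
      by (intro mesh_integral_sum n_pos L2_square G)
    also have "\<dots> \<le> (\<Sum>i=1..n. (mesh n / pi)\<^sup>2 * (LINT x:{node n (i - 1)<..<node n i}|lborel. (g x)\<^sup>2) + mesh n * (cell_mean n i g * cell_mean n i g))"
    proof (rule sum_mono)
      fix i assume i: "i \<in> {1..n}"
      have le1: "node n i \<le> 1" using i n_pos by (auto intro: node_le_1)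
      have len: "node n i - node n (i - 1) = mesh n" using i by (simp add: node_pred)
      have "(LINT x:{node n (i - 1)<..<node n i}|lborel. (?G x)\<^sup>2)
        \<le> ((node n i - node n (i - 1)) / pi)\<^sup>2 * (LINT x:{node n (i - 1)<..<node n i}|lborel. (g x)\<^sup>2)
          + (LINT x:{node n (i - 1)<..<node n i}|lborel. ?G x)\<^sup>2 / (node n i - node n (i - 1))"
      proof (rule Poincare_Wirtinger)
        show "node n (i - 1) < node n i" using len mesh_n_pos by linarith
        show "g \<in> L2 (node n (i - 1)) (node n i)" by (rule L2_subset[OF g(1) node_nonneg le1])
        show "?G x = ?G (node n (i - 1)) + prim (node n (i - 1)) g x" if "x \<in> {node n (i - 1)..node n i}" for x
          unfolding prim_def[of "node n (i - 1)"] using prim_diff[OF gi node_nonneg, of n "i - 1" x] that le1 by simp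
      qed
      also have "(LINT x:{node n (i - 1)<..<node n i}|lborel. ?G x)\<^sup>2 / (node n i - node n (i - 1)) = mesh n * (cell_mean n i g * cell_mean n i g)"
        unfolding len cell_integral_eq_mean[OF i] using mesh_n_pos by (simp add: power2_eq_square)
      finally show "(LINT x:{node n (i - 1)<..<node n i}|lborel. (?G x)\<^sup>2)
        \<le> (mesh n / pi)\<^sup>2 * (LINT x:{node n (i - 1)<..<node n i}|lborel. (g x)\<^sup>2) + mesh n * (cell_mean n i g * cell_mean n i g)"
        unfolding len .
    qed
    also have "\<dots> = (mesh n / pi)\<^sup>2 * I + mesh n * (\<Sum>i=1..n. cell_mean n i g * cell_mean n i g)"
      unfolding I_def mesh_integral_sum[OF n_pos L2_square[OF g(1)]] by (simp only: sum.distrib sum_distrib_left)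
    finally have "\<epsilon>\<^sup>2 * I + (LINT x:{0<..<1}|lborel. (?G x)\<^sup>2) - ?m\<^sup>2
        \<le> (\<epsilon>\<^sup>2 + (mesh n)\<^sup>2 / pi\<^sup>2) * I + mesh n * (\<Sum>i=1..n. cell_mean n i g * cell_mean n i g) - ?m\<^sup>2"
      by (simp add: power_divide algebra_simps)
    moreover have "(\<epsilon>\<^sup>2 + (mesh n)\<^sup>2 / pi\<^sup>2) * I \<le> \<kappa>\<^sup>2 * I"
      using \<kappa> by (intro mult_right_mono) (auto simp: I_def intro: set_integral_nonneg_real)
    moreover have "norm_form \<kappa> n g g = \<kappa>\<^sup>2 * I + mesh n * (\<Sum>i=1..n. cell_mean n i g * cell_mean n i g) - ?m\<^sup>2"
      by (simp add: norm_form_def I_def mesh_def power2_eq_square)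
    ultimately show ?thesis by linarith
  qed
  finally show ?thesis .
qed

text \<open>
  Adding a constant to \<open>\<epsilon> w' - w\<close> does not change its pairing with the derivative of a test function,
  and the mean of \<open>w\<close> is the constant for which the norm of the residual becomes smallest.
\<close>
lemma conv_form_bounded:
  assumes g: "g \<in> L2 0 1" "prim 0 g 1 = 0" and \<kappa>: "\<epsilon>\<^sup>2 + (mesh n)\<^sup>2 / pi\<^sup>2 \<le> \<kappa>\<^sup>2"
    and d: "(\<Sum>i=1..n. d i) = 0"
  shows "(conv_form \<epsilon> g (mesh_deriv n \<beta> d))\<^sup>2 \<le> norm_form \<kappa> n g g * ((1 + b\<^sub>2) * (mesh n * (\<Sum>i=1..n. (d i)\<^sup>2)))"
proof -
  let ?k = "mesh_deriv n \<beta> d" and ?m = "total_mean g"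
  note k = mesh_deriv_L2[of d]
  have r0: "(\<lambda>x. \<epsilon> * g x - prim 0 g x) \<in> L2 0 1"
    by (intro L2_diff L2_cmult g(1) continuous_L2 prim_continuous L2_integrable)
  have r: "(\<lambda>x. \<epsilon> * g x - prim 0 g x + ?m) \<in> L2 0 1"
    by (intro L2_add r0 continuous_L2 continuous_on_const)
  have "(LINT x:{0<..<1}|lborel. (\<epsilon> * g x - prim 0 g x + ?m) * ?k x)
      = (LINT x:{0<..<1}|lborel. (\<epsilon> * g x - prim 0 g x) * ?k x + ?m * ?k x)"
    by (simp add: algebra_simps)
  also have "\<dots> = conv_form \<epsilon> g ?k + ?m * prim 0 ?k 1"
    unfolding conv_form_eq[OF g(1) k g(2)] prim_def[of 0 ?k] set_integral_mult_right[symmetric]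
    by (intro set_integral_add(2) set_integrable_mult_right L2_mult r0 k L2_integrable)
  finally have "conv_form \<epsilon> g ?k = (LINT x:{0<..<1}|lborel. (\<epsilon> * g x - prim 0 g x + ?m) * ?k x)"
    using d by (simp add: mesh_deriv_total)
  then have "(conv_form \<epsilon> g ?k)\<^sup>2 \<le> (LINT x:{0<..<1}|lborel. (\<epsilon> * g x - prim 0 g x + ?m)\<^sup>2) * (LINT x:{0<..<1}|lborel. (?k x)\<^sup>2)"
    using L2_Cauchy_Schwarz[OF r k] by simp
  also have "\<dots> \<le> norm_form \<kappa> n g g * (LINT x:{0<..<1}|lborel. (?k x)\<^sup>2)"
    by (intro mult_right_mono residual_energy_le_norm_form[OF g \<kappa>] set_integral_nonneg_real) simp
  finally show ?thesis by (simp add: mesh_deriv_energy)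
qed

text \<open>
  The trial function is the discrete solution belonging to the combination on the right, because \<open>k\<close>
  is annihilated by the test space.  Testing with the optimal slopes \<open>d\<close> gives \<open>p X\<close> on one side; on the
  other, boundedness gives the norm of the combination times the square root of \<open>(1 + b\<^sub>2) X\<close>.
\<close>
lemma projection_bounded:
  assumes s: "(\<Sum>i=1..n. s i) = 0" and k: "k \<in> L2 0 1" "prim 0 k 1 = 0" and b2: "0 \<le> b\<^sub>2"
    and \<kappa>: "\<epsilon>\<^sup>2 + (mesh n)\<^sup>2 / pi\<^sup>2 \<le> (\<epsilon> + mesh n * b\<^sub>1)\<^sup>2"
    and orth: "\<And>d. (\<Sum>i=1..n. d i) = 0 \<Longrightarrow> conv_form \<epsilon> k (mesh_deriv n \<beta> d) = 0"
  defines "N \<equiv> \<lambda>g. norm_form (\<epsilon> + mesh n * b\<^sub>1) n g g"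
  shows "p\<^sup>2 * N (trial_deriv n s) \<le> (1 + b\<^sub>2) * N (\<lambda>x. p * trial_deriv n s x + q * k x)"
proof -
  let ?\<kappa> = "\<epsilon> + mesh n * b\<^sub>1"
  let ?t = "trial_deriv n s"
  define d where "d i = ?\<kappa> * s i - cell_mean n i ?t + total_mean ?t" for i
  define X where "X = N ?t"
  have d0: "(\<Sum>i=1..n. d i) = 0"
    unfolding d_def
    using trial_parts[OF s, of s] n_pos
    by (intro sum_cell_means_residual(3)[OF s _ total_mean_eq_cells[OF n_pos trial_deriv_L2]]) (auto simp: mesh_def)
  have X: "X = mesh n * (\<Sum>i=1..n. (d i)\<^sup>2)"
    unfolding X_def N_def d_def by (rule norm_form_trial(1)[OF s])
  have test: "conv_form \<epsilon> ?t (mesh_deriv n \<beta> d) = X"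
    unfolding conv_form_trial_test[OF s] X using norm_form_trial(2)[OF s, of ?\<kappa>] by (simp add: d_def)
  let ?w = "\<lambda>x. p * ?t x + q * k x"
  have w: "?w \<in> L2 0 1" by (rule L2_lincomb[OF trial_deriv_L2 k(1)])
  have w0: "prim 0 ?w 1 = 0"
    using prim_lincomb[OF L2_integrable[OF trial_deriv_L2] L2_integrable[OF k(1)], of 1 p s q] s k(2)
    by (simp add: trial_deriv_total)
  have "conv_form \<epsilon> ?w (mesh_deriv n \<beta> d) = p * X"
    using conv_form_lincomb_left[OF trial_deriv_L2 k(1) mesh_deriv_L2, of \<epsilon> p s q d] orth[OF d0] test by simp
  then have "(p * X)\<^sup>2 \<le> N ?w * ((1 + b\<^sub>2) * X)"
    using conv_form_bounded[OF w w0 \<kappa> d0] by (simp add: N_def X)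
  then have "X * (p\<^sup>2 * X) \<le> X * ((1 + b\<^sub>2) * N ?w)"
    by (simp add: power2_eq_square mult_ac)
  moreover have "0 \<le> X" unfolding X_def N_def by (rule norm_form_nonneg[OF n_pos trial_deriv_L2])
  moreover have "0 \<le> (1 + b\<^sub>2) * N ?w"
    using norm_form_nonneg[OF n_pos w] b2 by (simp add: N_def)
  ultimately show ?thesis
    unfolding X_def[symmetric] by (cases "X = 0") (auto simp: mult_le_cancel_left)
qed

lemma quasi_optimality:
  assumes s: "(\<Sum>i=1..n. s i) = 0" and k: "k \<in> L2 0 1" "prim 0 k 1 = 0" and b2: "0 \<le> b\<^sub>2"
    and \<kappa>: "\<epsilon>\<^sup>2 + (mesh n)\<^sup>2 / pi\<^sup>2 \<le> (\<epsilon> + mesh n * b\<^sub>1)\<^sup>2"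
    and orth: "\<And>d. (\<Sum>i=1..n. d i) = 0 \<Longrightarrow> conv_form \<epsilon> k (mesh_deriv n \<beta> d) = 0"
  defines "N \<equiv> \<lambda>g. norm_form (\<epsilon> + mesh n * b\<^sub>1) n g g"
  shows "N k \<le> (1 + b\<^sub>2) * N (\<lambda>x. trial_deriv n s x + k x)"
proof -
  let ?\<kappa> = "\<epsilon> + mesh n * b\<^sub>1"
  note exp = norm_form_lincomb[OF n_pos trial_deriv_L2 k(1), of ?\<kappa>]
  have "N k \<le> (1 + b\<^sub>2) * (N (trial_deriv n s) + 2 * norm_form ?\<kappa> n (trial_deriv n s) k + N k)"
  proof (rule complementary_projection_bound)
    show "p\<^sup>2 * N (trial_deriv n s) \<le> (1 + b\<^sub>2) * (p\<^sup>2 * N (trial_deriv n s) + 2 * p * q * norm_form ?\<kappa> n (trial_deriv n s) k + q\<^sup>2 * N k)" for p q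
      using projection_bounded[OF s k b2 \<kappa> orth, of p q] unfolding exp N_def .
  qed (use b2 in \<open>auto simp: N_def intro!: norm_form_nonneg n_pos trial_deriv_L2 k\<close>)
  then show ?thesis using exp[of 1 s 1] by (simp add: N_def)
qed

end

text \<open>
  In the decomposition \<open>u - p = (u\<^sub>h - p) + (u - u\<^sub>h)\<close> the first summand is a trial function and the
  second, by Galerkin orthogonality, is annihilated by the test space.
\<close>
theorem theorem5p3:
  fixes \<epsilon> h b\<^sub>1 b\<^sub>2 :: real and n :: nat and f B u u\<^sub>h :: "real \<Rightarrow> real"
  assumes "\<epsilon> > 0"
    and "continuous_on {0..1} f"
    and "n \<ge> 2"
    and "h = mesh n"
    and "continuous_on {0..h} B"
    and "B \<in> H1 0 h"
    and "B 0 = 0"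
    and "B h = 0"
    and "(LINT x:{0<..<h}|lborel. B x) = b\<^sub>1 * h"
    and "b\<^sub>1 > 0"
    and "(LINT x:{0<..<h}|lborel. (weak_deriv 0 h B x)\<^sup>2) = b\<^sub>2 / h"
    and "b\<^sub>2 > 0"
    and "u \<in> H01 0 1"
    and "\<forall>v\<in>H01 0 1. bform \<epsilon> v u = L2_prod f v"
    and "u\<^sub>h \<in> trial_space n"
    and "\<forall>v\<in>test_space n B. bform \<epsilon> v u\<^sub>h = L2_prod f v"
    and "\<epsilon>\<^sup>2 + h\<^sup>2 / pi\<^sup>2 \<le> (\<epsilon> + h * b\<^sub>1)\<^sup>2"
  shows "discrete_optimal_norm \<epsilon> b\<^sub>1 b\<^sub>2 n (\<lambda>x. u x - u\<^sub>h x)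
       \<le> sqrt (1 + b\<^sub>2) *
         (INF p\<in>trial_space n. discrete_optimal_norm \<epsilon> b\<^sub>1 b\<^sub>2 n (\<lambda>x. u x - p x))"
proof -
  have n_pos: "n > 0" using assms(3) by simp
  have hpos: "0 < h" using mesh_pos[OF n_pos] assms(4) by simp
  define \<beta> where "\<beta> = weak_deriv 0 h B"
  obtain g0 where g0: "has_weak_deriv 0 h B g0" using assms(6) by (auto simp: H1_def)
  have \<beta>: "has_weak_deriv 0 h B \<beta>" "\<beta> \<in> L2 0 h"
    unfolding \<beta>_def by (rule has_weak_deriv_weak_deriv[OF g0], rule weak_deriv_L2[OF g0])
  obtain c where c: "AE x\<in>{0<..<h} in lborel. B x = c + prim 0 \<beta> x"
    using has_weak_deriv_imp_prim[OF hpos continuous_integrable[OF assms(5)] \<beta>(1)] by blast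
  (* Continuity upgrades the almost everywhere identity, and B 0 = 0 removes the constant. *)
  have Bp: "B x = prim 0 \<beta> x" if "x \<in> {0..h}" for x
  proof -
    note \<beta>i = L2_integrable[OF \<beta>(2)]
    have "B x - (c + prim 0 \<beta> x) = 0" if "x \<in> {0..h}" for x
    proof (rule continuous_AE_zero[OF hpos _ _ that])
      show "continuous_on {0..h} (\<lambda>x. B x - (c + prim 0 \<beta> x))"
        by (intro continuous_intros assms(5) prim_continuous \<beta>i)
      show "AE x\<in>{0<..<h} in lborel. B x - (c + prim 0 \<beta> x) = 0"
        using c by eventually_elim simp
    qed
    from this[of 0] this[OF that] show ?thesis using assms(7) hpos by simp
  qed
  interpret mesh_bubble n B \<beta> b\<^sub>1 b\<^sub>2
    using n_pos \<beta>(2) Bp assms by unfold_locales (auto simp: \<beta>_def)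
  interpret Z: mesh_bubble n "\<lambda>_. 0" "\<lambda>_. 0" 0 0
    by (rule trial_mesh_bubble[OF n_pos])
  obtain g where g: "zero_primitive 0 1 u g"
    using H01_zero_primitive[OF zero_less_one assms(13)] by blast
  obtain s where s: "(\<Sum>i=1..n. s i) = 0" "zero_primitive 0 1 u\<^sub>h (trial_deriv n s)"
    using Z.test_space_zero_primitive[of u\<^sub>h] assms(15) unfolding trial_space_eq trial_deriv_def by blast
  define k where "k x = 1 * g x + (- 1) * trial_deriv n s x" for x
  have e: "zero_primitive 0 1 (\<lambda>x. u x - u\<^sub>h x) k"
    using zero_primitive_lincomb[OF g s(2), of 1 "- 1"] by (simp add: k_def[abs_def])
  have gL: "g \<in> L2 0 1" using g by (simp add: zero_primitive_def)
  (* Both solutions satisfy the same equation on the test space, so the form annihilates the error. *)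
  have orth: "conv_form \<epsilon> k (mesh_deriv n \<beta> d) = 0" if d: "(\<Sum>i=1..n. d i) = 0" for d
  proof -
    obtain v where v: "v \<in> test_space n B" "zero_primitive 0 1 v (mesh_deriv n \<beta> d)"
      using test_space_exists[OF d] by blast
    have "bform \<epsilon> v u = L2_prod f v"
      by (rule weak_solution_tests_primitives[OF assms(2) g assms(14) v(2)])
    then have "conv_form \<epsilon> g (mesh_deriv n \<beta> d) = conv_form \<epsilon> (trial_deriv n s) (mesh_deriv n \<beta> d)"
      using zero_primitive_bform[OF g v(2), of \<epsilon>] zero_primitive_bform[OF s(2) v(2), of \<epsilon>] bspec[OF assms(16) v(1)]
      by simp
    then show ?thesis
      unfolding k_def[abs_def] conv_form_lincomb_left[OF gL trial_deriv_L2 mesh_deriv_L2] by simp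
  qed
  let ?N = "\<lambda>g. norm_form (\<epsilon> + mesh n * b\<^sub>1) n g g"
  have bound: "discrete_optimal_norm \<epsilon> b\<^sub>1 b\<^sub>2 n (\<lambda>x. u x - u\<^sub>h x)
      \<le> sqrt (1 + b\<^sub>2) * discrete_optimal_norm \<epsilon> b\<^sub>1 b\<^sub>2 n (\<lambda>x. u x - p x)" if p_in: "p \<in> trial_space n" for p
  proof -
    obtain t where t: "(\<Sum>i=1..n. t i) = 0" "zero_primitive 0 1 p (trial_deriv n t)"
      using Z.test_space_zero_primitive[of p] p_in unfolding trial_space_eq trial_deriv_def by blast
    define r where "r i = 1 * s i + (- 1) * t i" for i
    have r0: "(\<Sum>i=1..n. r i) = 0" using s(1) t(1) by (simp add: r_def sum_subtractf)
    have "1 * g x + (- 1) * trial_deriv n t x = trial_deriv n r x + k x" for x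
      using fun_cong[OF trial_deriv_lincomb[of 1 s "- 1" t], of x] by (simp add: k_def r_def[abs_def])
    then have p: "zero_primitive 0 1 (\<lambda>x. u x - p x) (\<lambda>x. trial_deriv n r x + k x)"
      using zero_primitive_lincomb[OF g t(2), of 1 "- 1"] by simp
    have "?N k \<le> (1 + b\<^sub>2) * ?N (\<lambda>x. trial_deriv n r x + k x)"
    proof (rule quasi_optimality[OF r0 _ _ _ _ orth])
      show "k \<in> L2 0 1" "prim 0 k 1 = 0" using e by (simp_all add: zero_primitive_def)
      show "\<epsilon>\<^sup>2 + (mesh n)\<^sup>2 / pi\<^sup>2 \<le> (\<epsilon> + mesh n * b\<^sub>1)\<^sup>2" using assms(17) unfolding assms(4) .
      show "0 \<le> b\<^sub>2" using assms(12) by simp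
    qed
    then have "?N k / (1 + b\<^sub>2) \<le> (1 + b\<^sub>2) * ?N (\<lambda>x. trial_deriv n r x + k x) / (1 + b\<^sub>2)"
      using assms(12) by (intro divide_right_mono) auto
    then have "sqrt (?N k / (1 + b\<^sub>2)) \<le> sqrt ((1 + b\<^sub>2) * (?N (\<lambda>x. trial_deriv n r x + k x) / (1 + b\<^sub>2)))"
      by (intro real_sqrt_le_mono) simp
    then show ?thesis
      unfolding zero_primitive_norm[OF n_pos e] zero_primitive_norm[OF n_pos p] real_sqrt_mult .
  qed
  let ?e = "discrete_optimal_norm \<epsilon> b\<^sub>1 b\<^sub>2 n (\<lambda>x. u x - u\<^sub>h x)"
  have rpos: "0 < sqrt (1 + b\<^sub>2)" using assms(12) by simp
  have "?e / sqrt (1 + b\<^sub>2) \<le> (INF p\<in>trial_space n. discrete_optimal_norm \<epsilon> b\<^sub>1 b\<^sub>2 n (\<lambda>x. u x - p x))"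
  proof (rule cINF_greatest)
    show "trial_space n \<noteq> {}" using assms(15) by blast
    show "?e / sqrt (1 + b\<^sub>2) \<le> discrete_optimal_norm \<epsilon> b\<^sub>1 b\<^sub>2 n (\<lambda>x. u x - p x)" if "p \<in> trial_space n" for p
      using bound[OF that] rpos by (simp add: pos_divide_le_eq mult.commute)
  qed
  then show ?thesis using rpos by (simp add: pos_divide_le_eq mult.commute)
qed

end
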